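(* There exists an integer $n_0$ such that for all integers $n\ge n_0$ and all integers $s,t$ with $2\le s\le t\le \frac{\log n}{120\log\log n}$, \[ 2^{\frac{n}{32t}\log\left(\frac{2et}{s}\right)}\;\le\; f_{s+t-2}(n,s,t)\;\le\; 2^{\frac{4n}{t}\log\left(\frac{2et}{s}\right)}. \]
   Context: All logarithms are to base $2$, and $e$ is the base of the natural logarithm. For integers $n\ge k\ge s,t\ge 2$, $f_k(n,s,t)$ denotes the least integer $N$ with the following property: for every coloring of the $k$-element subsets of $\{1,\dots,N\}$ with the two colors red and blue, there is a subset $A\subseteq\{1,\dots,N\}$ with $|A|=n$ such that either every $s$-element subset of $A$ is contained in some red $k$-element subset of $\{1,\dots,N\}$, or every $t$-element subset of $A$ is contained in some blue $k$-element subset of $\{1,\dots,N\}$ (the $k$-subsets need not be contained in $A$). *)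

theory Defs
  imports Complex_Main "HOL-Library.Ramsey"
begin

datatype color = Red | Blue

definition covered :: "(nat set \<Rightarrow> color) \<Rightarrow> color \<Rightarrow> nat \<Rightarrow> nat \<Rightarrow> nat \<Rightarrow> nat set \<Rightarrow> bool" where
  "covered \<chi> col k N r A \<longleftrightarrow>
     (\<forall>S \<in> [A]\<^bsup>r\<^esup>. \<exists>K \<in> [{1..N}]\<^bsup>k\<^esup>. S \<subseteq> K \<and> \<chi> K = col)"

text \<open>A coloring is a total function on sets of naturals; only its values on the
  \<open>k\<close>-element subsets of \<open>{1..N}\<close> matter.\<close>

definition cover_ramsey :: "nat \<Rightarrow> nat \<Rightarrow> nat \<Rightarrow> nat \<Rightarrow> nat \<Rightarrow> bool" where
  "cover_ramsey k n s t N \<longleftrightarrow>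
     (\<forall>\<chi> :: nat set \<Rightarrow> color. \<exists>A \<in> [{1..N}]\<^bsup>n\<^esup>.
        covered \<chi> Red k N s A \<or> covered \<chi> Blue k N t A)"

lemma cover_ramsey_ex:
  assumes "s \<le> k" "t \<le> k" "k \<le> n"
  shows "\<exists>N. cover_ramsey k n s t N"
proof -
  obtain N :: nat where N: "partn_lst {..<N} [n, n] k"
    using ramsey_full by blast
  have "cover_ramsey k n s t N"
    unfolding cover_ramsey_def
  proof
    fix \<chi> :: "nat set \<Rightarrow> color"
    define f where "f K = (if \<chi> (Suc ` K) = Red then 0 else 1 :: nat)" for K
    have "f \<in> nsets {..<N} k \<rightarrow> {..<length [n, n]}"
      by (auto simp: f_def)
    then obtain i H where i: "i < length [n, n]" and H: "H \<in> nsets {..<N} ([n, n] ! i)"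
      and mono: "f ` nsets H k \<subseteq> {i}"
      using N unfolding partn_lst_def monochromatic_def by metis
    have "[n, n] ! i = n"
      using i by (auto simp: less_Suc_eq)
    then have H': "H \<subseteq> {..<N}" "finite H" "card H = n"
      using H by (auto simp: nsets_def)
    define A where "A = Suc ` H"
    have A: "A \<subseteq> {1..N}" "finite A" "card A = n"
      using H' by (auto simp: A_def card_image)
    have col: "\<chi> K = (if i = 0 then Red else Blue)" if K: "K \<in> nsets A k" for K
    proof -
      obtain L where L: "L \<subseteq> H" "K = Suc ` L"
        using K unfolding A_def nsets_def by (auto simp: subset_image_iff)
      then have "L \<in> nsets H k"
        using K H'(2) by (auto simp: nsets_def card_image finite_subset)
      then have "f L = i"
        using mono by auto
      then show ?thesis
        using L(2) by (cases "\<chi> K") (auto simp: f_def)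
    qed
    have ext: "\<exists>K \<in> nsets A k. S \<subseteq> K" if "S \<in> nsets A r" "r \<le> k" for S r
      using that A assms(3) obtain_subset_with_card_n exists_subset_between[of S k A]
      by (auto simp: nsets_def intro: finite_subset)
    have "covered \<chi> (if i = 0 then Red else Blue) k N r A" if "r \<le> k" for r
      unfolding covered_def using ext[OF _ that] col nsets_mono[OF A(1), of k] by blast
    then have "covered \<chi> Red k N s A \<or> covered \<chi> Blue k N t A"
      using assms(1,2) by metis
    then show "\<exists>A \<in> nsets {1..N} n. covered \<chi> Red k N s A \<or> covered \<chi> Blue k N t A"
      using A by (auto simp: nsets_def)
  qed
  then show ?thesis ..
qed

text \<open>Meaningful for \<open>n \<ge> k \<ge> s, t \<ge> 2\<close>: there such an \<open>N\<close> exists by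
  Ramsey's theorem (lemma \<open>cover_ramsey_ex\<close>).\<close>

definition cover_ramsey_number :: "nat \<Rightarrow> nat \<Rightarrow> nat \<Rightarrow> nat \<Rightarrow> nat" where
  "cover_ramsey_number k n s t = (LEAST N. cover_ramsey k n s t N)"

end

theory Submission
  imports Defs "HOL-Real_Asymp.Real_Asymp"
begin

text \<open>
  With \<open>k = s + t - 2\<close>, a \<open>k\<close>-set cannot contain an \<open>s\<close>-set and a \<open>t\<close>-set meeting in at most one point,
  but any two meeting in at least two points fit into a \<open>k\<close>-set. Hence the number is the least \<open>N\<close> such
  that every graph on \<open>N\<close> vertices has an \<open>n\<close>-set of vertices without an \<open>s\<close>-clique or without an
  independent \<open>t\<close>-set. Write \<open>y = 2et/s\<close>.

  Upper bound: by the Erdos-Szekeres bound one repeatedly removes cliques of size about \<open>n/(t - 1)\<close> or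
  independent sets of size about \<open>n/(s - 1)\<close>; the union of \<open>t - 1\<close> of the former, or of \<open>s - 1\<close> of the
  latter, is the required set.

  Lower bound: take a random graph with edge probability \<open>p = y\<^sup>-\<^sup>1\<^sup>/\<^sup>3\<close>. One needs that a random graph on
  \<open>n\<close> vertices is \<open>s\<close>-clique-free with probability at most about \<open>(1 - p)\<close> to the power
  \<open>n\<^sup>2/(10s)\<close>. If \<open>C\<close> misses at most \<open>n\<^sup>2/(9s)\<close> pairs, then on a suitable set of vertices all cliques of
  \<open>C\<close> with fewer than \<open>s\<close> vertices have linearly many common \<open>C\<close>-neighbours. An \<open>s\<close>-clique-free
  \<open>E \<subseteq> C\<close> blocks the greedy search for an \<open>s\<close>-clique, and a blocked search exhibits a set
  \<open>D \<subseteq> C\<close> of \<open>n\<^bsup>2 - o(1)\<^esup>\<close> pairs on which \<open>E\<close> is sparse, where \<open>D\<close> is one of only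
  \<open>n\<^bsup>O(sn)\<^esup>\<close> sets determined by \<open>C\<close>. A union bound over \<open>D\<close> followed by induction on \<open>C - D\<close> gains a
  factor of about \<open>1 - p\<close> for each pair removed until \<open>n\<^sup>2/(9s)\<close> pairs are missing.
\<close>

subsection \<open>Blocked clique searches\<close>

definition clique_free :: "nat \<Rightarrow> 'a set \<Rightarrow> 'a set set \<Rightarrow> bool" where
  "clique_free s V E \<longleftrightarrow> (\<forall>S \<in> [V]\<^bsup>s\<^esup>. \<not> [S]\<^bsup>2\<^esup> \<subseteq> E)"

definition common_nbs :: "'a set set \<Rightarrow> 'a set \<Rightarrow> 'a set \<Rightarrow> 'a set" where
  "common_nbs C P U = {y \<in> U. \<forall>x \<in> P. {x, y} \<in> C}"

text \<open>This is the set \<open>D\<close> of the overview. The graph \<open>E\<close> does not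
  occur in it, so a union bound over the choices of \<open>U\<close> and \<open>P\<close> reaches
  every \<open>E\<close>.\<close>

definition link_pairs :: "'a set set \<Rightarrow> 'a set \<Rightarrow> ('a \<Rightarrow> 'a set) \<Rightarrow> 'a set set" where
  "link_pairs C U P = {{v, y} | v y. v \<in> U \<and> y \<in> common_nbs C (insert v (P v)) U}"

lemma nsets2_insert: "x \<notin> P \<Longrightarrow> [insert x P]\<^bsup>2\<^esup> = [P]\<^bsup>2\<^esup> \<union> (\<lambda>y. {x, y}) ` P"
proof -
  assume "x \<notin> P"
  then have "[insert x P]\<^bsup>2\<^esup> = [{x} \<union> P]\<^bsup>2\<^esup>" and "{x} \<inter> P = {}" by auto
  then show ?thesis
    by (auto simp: nsets_disjoint_2 simp del: Un_insert_left) (auto simp: nsets_2_eq)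
qed

lemma link_pairs_subset: "link_pairs C U P \<subseteq> C"
  by (auto simp: link_pairs_def common_nbs_def)

lemma card_doubletons_le:
  assumes "finite R"
  shows "card R \<le> 2 * card ((\<lambda>(v, y). {v, y}) ` R)"
proof -
  let ?f = "\<lambda>(v, y). {v, y}"
  have "card R = (\<Sum>e \<in> ?f ` R. card {r \<in> R. ?f r = e})"
    using sum.group[OF assms, of "?f ` R" ?f "\<lambda>_. 1 :: nat"] assms by simp
  also have "\<dots> \<le> (\<Sum>e \<in> ?f ` R. 2)"
  proof (rule sum_mono)
    fix e assume "e \<in> ?f ` R"
    then obtain v y where e: "e = {v, y}" by auto
    have "{r \<in> R. ?f r = e} \<subseteq> {(v, y), (y, v)}"
    proof
      fix r assume "r \<in> {r \<in> R. ?f r = e}"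
      then have "{fst r, snd r} = {v, y}" by (simp add: e case_prod_beta)
      then show "r \<in> {(v, y), (y, v)}" unfolding doubleton_eq_iff by (cases r) simp
    qed
    then have "card {r \<in> R. ?f r = e} \<le> card {(v, y), (y, v)}"
      by (intro card_mono) auto
    also have "\<dots> \<le> 2"
      using card_length[of "[(v, y), (y, v)]"] by simp
    finally show "card {r \<in> R. ?f r = e} \<le> 2" .
  qed
  finally show ?thesis by simp
qed

text \<open>If the greedy search for an \<open>s\<close>-clique of \<open>E\<close> is blocked at the candidate set \<open>U\<close>, then each
  \<open>v \<in> U\<close> has a witness \<open>P v\<close> for which \<open>E\<close> is sparse between \<open>v\<close> and the \<open>C\<close>-neighbours
  of \<open>insert v (P v)\<close>. The set \<open>U\<close> and the witnesses determine all the sparse pairs.\<close>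

lemma sparse_link_pairs:
  fixes \<epsilon> \<beta> :: real
  assumes fin: "finite V" and CV: "C \<subseteq> [V]\<^bsup>2\<^esup>" and EC: "E \<subseteq> C" and free: "clique_free s V E"
    and eps: "0 < \<epsilon>" "\<epsilon> \<le> 1" and beta: "\<beta> > 0" and WV: "W \<subseteq> V"
    and rich: "\<And>P. P \<subseteq> W \<Longrightarrow> [P]\<^bsup>2\<^esup> \<subseteq> C \<Longrightarrow> card P < s \<Longrightarrow> \<beta> \<le> card (common_nbs C P W)"
  obtains U P where "U \<subseteq> V" "\<And>v. v \<in> U \<Longrightarrow> P v \<subseteq> V \<and> card (P v) < s"
    "(\<epsilon> ^ s * \<beta>)\<^sup>2 \<le> 2 * card (link_pairs C U P)"
    "card (E \<inter> link_pairs C U P) \<le> 2 * \<epsilon> * card (link_pairs C U P)"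
proof -
  define U where "U Z = common_nbs E Z W" for Z
  \<comment> \<open>\<open>Z\<close> is the clique of \<open>E\<close> chosen so far and
    \<open>U Z\<close> the set of candidates for the next vertex. The invariant says that, for
    cliques \<open>P\<close> still within the size limit, the richness of \<open>W\<close> survives
    in \<open>U Z\<close> at the cost of a factor \<epsilon> per chosen vertex.\<close>
  define inv where "inv Z \<longleftrightarrow> (\<forall>P \<subseteq> U Z. [P]\<^bsup>2\<^esup> \<subseteq> C \<longrightarrow> card P + card Z < s \<longrightarrow>
      \<epsilon> ^ card Z * \<beta> \<le> card (common_nbs C P (U Z)))" for Z
  have UW: "U Z \<subseteq> W" for Z
    by (auto simp: U_def common_nbs_def)
  have finU: "finite (U Z)" for Z
    using finite_subset[OF UW] finite_subset[OF WV fin] by blast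
  have irrefl: "{x} \<notin> C" for x
    using CV by (auto simp: nsets_def)
  have U_insert: "U (insert v Z) = {y \<in> U Z. {v, y} \<in> E}" for v Z
    by (auto simp: U_def common_nbs_def)
  \<comment> \<open>The search must stop: if some candidate always preserved \<open>inv\<close>,
    then \<open>s\<close> choices would produce an \<open>s\<close>-clique of \<open>E\<close>.
    Where it stops, every candidate breaks \<open>inv\<close>.\<close>
  have "\<exists>Z. Z \<subseteq> V \<and> card Z < s \<and> inv Z \<and> (\<forall>v \<in> U Z. \<not> inv (insert v Z))"
  proof (rule ccontr)
    assume no: "\<nexists>Z. Z \<subseteq> V \<and> card Z < s \<and> inv Z \<and> (\<forall>v \<in> U Z. \<not> inv (insert v Z))"
    have "\<exists>Z. Z \<subseteq> V \<and> card Z = i \<and> [Z]\<^bsup>2\<^esup> \<subseteq> E \<and> inv Z" if "i \<le> s" for i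
      using that
    proof (induction i)
      case 0
      have "U {} = W" by (simp add: U_def common_nbs_def)
      then have "inv {}" using rich by (simp add: inv_def)
      then show ?case by (intro exI[of _ "{}"]) (auto simp: nsets_2_eq)
    next
      case (Suc i)
      then obtain Z where Z: "Z \<subseteq> V" "card Z = i" "[Z]\<^bsup>2\<^esup> \<subseteq> E" "inv Z" by auto
      then obtain v where v: "v \<in> U Z" "inv (insert v Z)"
        using no Suc.prems by force
      have vZ: "v \<notin> Z"
        using v(1) irrefl EC by (force simp: U_def common_nbs_def)
      have "insert v Z \<subseteq> V" using v(1) Z(1) UW WV by auto
      moreover have "card (insert v Z) = Suc i"
        using vZ Z finite_subset[OF Z(1) fin] by simp
      moreover have "[insert v Z]\<^bsup>2\<^esup> \<subseteq> E"
        using Z(3) v(1) unfolding nsets2_insert[OF vZ]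
        by (auto simp: U_def common_nbs_def insert_commute)
      ultimately show ?case using v(2) by blast
    qed
    from this[of s] obtain Z where "Z \<subseteq> V" "card Z = s" "[Z]\<^bsup>2\<^esup> \<subseteq> E" by auto
    then show False
      using free finite_subset[OF _ fin] by (auto simp: clique_free_def nsets_def)
  qed
  then obtain Z where Z: "Z \<subseteq> V" "card Z < s" "inv Z" "\<And>v. v \<in> U Z \<Longrightarrow> \<not> inv (insert v Z)"
    by auto
  define i where "i = card Z"
  define b where "b = \<epsilon> ^ i * \<beta>"
  have b0: "b > 0" using eps beta by (simp add: b_def)
  \<comment> \<open>The witness for \<open>v\<close> is a clique at which the invariant of
    \<open>insert v Z\<close> fails.\<close>
  have "\<exists>P. P \<subseteq> U (insert v Z) \<and> [P]\<^bsup>2\<^esup> \<subseteq> C \<and> card P + Suc i < s \<and>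
      card (common_nbs C P (U (insert v Z))) < \<epsilon> * b" if v: "v \<in> U Z" for v
  proof -
    have "v \<notin> Z"
      using v irrefl EC by (force simp: U_def common_nbs_def)
    then have "card (insert v Z) = Suc i"
      using finite_subset[OF Z(1) fin] by (simp add: i_def)
    then show ?thesis
      using Z(4)[OF v] by (auto simp: inv_def not_le b_def mult.assoc)
  qed
  then obtain P where P: "\<And>v. v \<in> U Z \<Longrightarrow> P v \<subseteq> U (insert v Z) \<and> [P v]\<^bsup>2\<^esup> \<subseteq> C \<and>
      card (P v) + Suc i < s \<and> card (common_nbs C (P v) (U (insert v Z))) < \<epsilon> * b"
    by metis
  define X where "X v = common_nbs C (insert v (P v)) (U Z)" for v
  define R where "R = (SIGMA v : U Z. X v)"
  define R' where "R' = (SIGMA v : U Z. {y \<in> X v. {v, y} \<in> E})"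
  have finX: "finite (X v)" for v
    using finU by (simp add: X_def common_nbs_def)
  have finR: "finite R" "finite R'"
    using finU finX by (auto simp: R_def R'_def)
  \<comment> \<open>\<open>P v\<close> consists of \<open>E\<close>-neighbours of \<open>v\<close>,
    so \<open>insert v (P v)\<close> is a clique of \<open>C\<close> inside \<open>U Z\<close>. The
    invariant of \<open>Z\<close> applies to it: \<open>v\<close> has only moved from the side of
    \<open>Z\<close> to the side of the clique, and the total size is unchanged.\<close>
  have Xbig: "b \<le> card (X v)" if v: "v \<in> U Z" for v
  proof -
    have sub: "insert v (P v) \<subseteq> U Z" using P[OF v] U_insert v by auto
    have vP: "v \<notin> P v" using P[OF v] U_insert irrefl EC by auto
    have "[insert v (P v)]\<^bsup>2\<^esup> \<subseteq> C"
      unfolding nsets2_insert[OF vP] using P[OF v] U_insert EC by blast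
    moreover have "card (insert v (P v)) + card Z < s"
      using P[OF v] card_insert_le_m1[of "Suc (card (P v))" "P v" v] i_def by simp
    ultimately show ?thesis
      using Z(3) sub by (auto simp: inv_def X_def b_def i_def)
  qed
  \<comment> \<open>The \<open>E\<close>-neighbours of \<open>v\<close> in \<open>X v\<close> are
    exactly the common neighbours that were too few when \<open>P v\<close> was chosen.\<close>
  have Xsparse: "card {y \<in> X v. {v, y} \<in> E} \<le> \<epsilon> * card (X v)" if v: "v \<in> U Z" for v
  proof -
    have "{y \<in> X v. {v, y} \<in> E} = common_nbs C (P v) (U (insert v Z))"
      using EC by (auto simp: X_def common_nbs_def[of C] U_insert)
    then have "card {y \<in> X v. {v, y} \<in> E} \<le> \<epsilon> * b"
      using P[OF v] by simp
    also have "\<dots> \<le> \<epsilon> * card (X v)"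
      using Xbig[OF v] eps by simp
    finally show ?thesis .
  qed
  have Ubig: "b \<le> card (U Z)"
  proof -
    have "b \<le> card (common_nbs C {} (U Z))"
      using Z(2,3) unfolding inv_def b_def i_def by (auto simp: nsets_2_eq)
    then show ?thesis by (simp add: common_nbs_def)
  qed
  let ?f = "\<lambda>(v, y). {v, y}"
  have D: "link_pairs C (U Z) P = ?f ` R"
    by (force simp: link_pairs_def R_def X_def)
  have D': "E \<inter> link_pairs C (U Z) P \<subseteq> ?f ` R'"
    by (force simp: link_pairs_def R'_def X_def)
  have cR: "real (card R) = (\<Sum>v \<in> U Z. real (card (X v)))"
    unfolding R_def using finU finX by (subst card_SigmaI) auto
  have cR': "real (card R') \<le> \<epsilon> * card R"
  proof -
    have "real (card R') = (\<Sum>v \<in> U Z. real (card {y \<in> X v. {v, y} \<in> E}))"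
      unfolding R'_def using finU finX by (subst card_SigmaI) auto
    also have "\<dots> \<le> (\<Sum>v \<in> U Z. \<epsilon> * card (X v))"
      by (intro sum_mono Xsparse)
    finally show ?thesis by (simp add: cR sum_distrib_left)
  qed
  \<comment> \<open>A pair may be counted from both of its ends; this causes the factors 2 in the
    conclusions.\<close>
  have half: "card R \<le> 2 * card (link_pairs C (U Z) P)"
    unfolding D using finR(1) by (rule card_doubletons_le)
  show thesis
  proof
    show "U Z \<subseteq> V" using UW WV by blast
    show "P v \<subseteq> V \<and> card (P v) < s" if "v \<in> U Z" for v
      using P[OF that] UW WV by fastforce
    have "\<epsilon> ^ s * \<beta> \<le> b"
      using eps beta Z(2) by (auto simp: b_def i_def intro!: power_decreasing mult_right_mono)
    then have "(\<epsilon> ^ s * \<beta>)\<^sup>2 \<le> b\<^sup>2"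
      using eps beta by (intro power_mono) auto
    also have "\<dots> \<le> card (U Z) * b"
      using Ubig b0 by (simp add: power2_eq_square)
    also have "\<dots> \<le> card R"
      unfolding cR using sum_mono[of "U Z" "\<lambda>_. b" "\<lambda>v. real (card (X v))"] Xbig by simp
    also have "\<dots> \<le> 2 * card (link_pairs C (U Z) P)"
      using half by linarith
    finally show "(\<epsilon> ^ s * \<beta>)\<^sup>2 \<le> 2 * card (link_pairs C (U Z) P)" by simp
    have "card (E \<inter> link_pairs C (U Z) P) \<le> card R'"
      using D' finR(2) by (meson card_image_le card_mono finite_imageI le_trans)
    then have "real (card (E \<inter> link_pairs C (U Z) P)) \<le> \<epsilon> * card R"
      using cR' by linarith
    also have "\<dots> \<le> \<epsilon> * (2 * card (link_pairs C (U Z) P))"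
      using half eps by (intro mult_left_mono) linarith+
    finally show "card (E \<inter> link_pairs C (U Z) P) \<le> 2 * \<epsilon> * card (link_pairs C (U Z) P)"
      by (simp add: ac_simps)
  qed
qed

text \<open>Two common points would form a pair both inside and outside \<open>F\<close>. This fact
  about a clique and an independent set serves both bounds.\<close>

lemma card_Int_homogeneous:
  assumes "finite S" and "[S]\<^bsup>2\<^esup> \<subseteq> F" "[I]\<^bsup>2\<^esup> \<inter> F = {}"
  shows "card (I \<inter> S) \<le> 1"
proof -
  have "x = y" if "x \<in> I \<inter> S" "y \<in> I \<inter> S" for x y
    using that assms(2,3) doubleton_in_nsets_2[of x y] by (metis IntD1 IntD2 disjoint_iff subsetD)
  then show ?thesis using assms(1) by (simp add: card_le_Suc0_iff_eq)
qed

lemma mult_120_le: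
  fixes x L :: real
  assumes "4 \<le> L" "0 \<le> x" "x \<le> L / (120 * log 2 L)"
  shows "120 * x \<le> L"
proof -
  have "log 2 2 \<le> log 2 L" using assms(1) by (subst log_le_cancel_iff) auto
  then have l: "1 \<le> log 2 L" by simp
  have "x * (120 * 1) \<le> x * (120 * log 2 L)"
    using l assms(2) by (intro mult_left_mono) auto
  also have "\<dots> \<le> L" using assms(3) l by (simp add: field_simps)
  finally show ?thesis by simp
qed

subsection \<open>Random subsets\<close>

text \<open>The probability that \<open>X\<close> holds for a random subset of \<open>C\<close>
  containing each element independently with probability \<open>p\<close>, written as a finite sum
  instead of a measure.\<close>

definition bernoulli_weight :: "real \<Rightarrow> 'a set \<Rightarrow> ('a set \<Rightarrow> bool) \<Rightarrow> real" where
  "bernoulli_weight p C X = (\<Sum>E | E \<subseteq> C \<and> X E. p ^ card E * (1 - p) ^ card (C - E))"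

lemma sum_Pow_powers:
  fixes a b :: "'b :: comm_ring_1"
  assumes "finite C"
  shows "(\<Sum>E \<in> Pow C. a ^ card E * b ^ card (C - E)) = (a + b) ^ card C"
  using prod_add[OF assms, of "\<lambda>_. a" "\<lambda>_. b"] by simp

lemma bernoulli_weight_nonneg: "0 \<le> p \<Longrightarrow> p \<le> 1 \<Longrightarrow> 0 \<le> bernoulli_weight p C X"
  unfolding bernoulli_weight_def by (intro sum_nonneg) auto

lemma bernoulli_weight_mono:
  assumes "finite C" "0 \<le> p" "p \<le> 1" "\<And>E. E \<subseteq> C \<Longrightarrow> X E \<Longrightarrow> Y E"
  shows "bernoulli_weight p C X \<le> bernoulli_weight p C Y"
  unfolding bernoulli_weight_def using assms by (intro sum_mono2) auto

lemma bernoulli_weight_True: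
  assumes "finite C"
  shows "bernoulli_weight p C (\<lambda>_. True) = 1"
  using sum_Pow_powers[OF assms, of p "1 - p"] by (simp add: bernoulli_weight_def Pow_def)

lemma bernoulli_weight_le_1:
  assumes "finite C" "0 \<le> p" "p \<le> 1"
  shows "bernoulli_weight p C X \<le> 1"
  using bernoulli_weight_mono[OF assms, of X "\<lambda>_. True"] bernoulli_weight_True[OF assms(1)] by simp

lemma bernoulli_weight_union_bound:
  assumes "finite C" "0 \<le> p" "p \<le> 1" "finite I" "\<And>E. E \<subseteq> C \<Longrightarrow> X E \<Longrightarrow> \<exists>i \<in> I. Y i E"
  shows "bernoulli_weight p C X \<le> (\<Sum>i \<in> I. bernoulli_weight p C (Y i))"
proof -
  let ?w = "\<lambda>E. p ^ card E * (1 - p) ^ card (C - E)"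
  have bw: "bernoulli_weight p C Z = (\<Sum>E \<in> Pow C. if Z E then ?w E else 0)" for Z
    unfolding bernoulli_weight_def using assms(1)
    by (intro sum.mono_neutral_cong_left) auto
  have "bernoulli_weight p C X \<le> (\<Sum>E \<in> Pow C. \<Sum>i \<in> I. if Y i E then ?w E else 0)"
    unfolding bw
  proof (rule sum_mono)
    fix E assume E: "E \<in> Pow C"
    have nonneg: "0 \<le> (if Y i E then ?w E else 0)" for i
      using assms(2,3) by simp
    show "(if X E then ?w E else 0) \<le> (\<Sum>i \<in> I. if Y i E then ?w E else 0)"
    proof (cases "X E")
      case True
      then obtain i where i: "i \<in> I" "Y i E"
        using assms(5) E by blast
      then have "?w E = (if Y i E then ?w E else 0)" by simp
      also have "\<dots> \<le> (\<Sum>i \<in> I. if Y i E then ?w E else 0)"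
        by (rule member_le_sum[OF i(1) nonneg assms(4)])
      finally show ?thesis using True by simp
    qed (simp add: sum_nonneg nonneg)
  qed
  also have "\<dots> = (\<Sum>i \<in> I. bernoulli_weight p C (Y i))"
    unfolding bw by (rule sum.swap)
  finally show ?thesis .
qed

text \<open>Independence of what happens on \<open>D\<close> and on \<open>C - D\<close>.\<close>

lemma bernoulli_weight_split:
  assumes fin: "finite C" and "D \<subseteq> C"
  shows "bernoulli_weight p C (\<lambda>E. X (E \<inter> D) \<and> Y (E \<inter> (C - D))) =
    bernoulli_weight p D X * bernoulli_weight p (C - D) Y"
proof -
  let ?w = "\<lambda>C E. p ^ card E * (1 - p) ^ card (C - E)"
  let ?S = "{E. E \<subseteq> D \<and> X E}" and ?T = "{E. E \<subseteq> C - D \<and> Y E}"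
  have finD: "finite D" using assms finite_subset by blast
  have "(\<Sum>E | E \<subseteq> C \<and> X (E \<inter> D) \<and> Y (E \<inter> (C - D)). ?w C E) =
      (\<Sum>(A, B) \<in> ?S \<times> ?T. ?w D A * ?w (C - D) B)"
  proof (rule sum.reindex_bij_witness[where i = "\<lambda>(A, B). A \<union> B" and
        j = "\<lambda>E. (E \<inter> D, E \<inter> (C - D))"], goal_cases)
    case (1 E) then show ?case by auto
  next
    case (2 E) then show ?case by auto
  next
    case (3 AB)
    then have "(fst AB \<union> snd AB) \<inter> D = fst AB" "(fst AB \<union> snd AB) \<inter> (C - D) = snd AB" by auto
    then show ?case by (cases AB) simp
  next
    case (4 AB)
    then have "(fst AB \<union> snd AB) \<inter> D = fst AB" "(fst AB \<union> snd AB) \<inter> (C - D) = snd AB" by auto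
    then show ?case using 4 assms(2) by (cases AB) auto
  next
    case (5 E)
    then have E: "E \<subseteq> C" by simp
    have "card E = card (E \<inter> D) + card (E \<inter> (C - D))"
      using E fin by (subst card_Un_disjoint[symmetric]) (auto intro: finite_subset arg_cong[where f = card])
    moreover have "card (C - E) = card (D - E \<inter> D) + card ((C - D) - E \<inter> (C - D))"
      using fin finD assms(2)
      by (subst card_Un_disjoint[symmetric]) (auto intro: arg_cong[where f = card])
    ultimately show ?case by (simp add: power_add)
  qed
  also have "\<dots> = (\<Sum>A \<in> ?S. ?w D A) * (\<Sum>B \<in> ?T. ?w (C - D) B)"
    by (simp add: sum_product sum.cartesian_product)
  finally show ?thesis by (simp add: bernoulli_weight_def)
qed

lemma bernoulli_weight_restrict:
  assumes "finite C" "D \<subseteq> C"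
  shows "bernoulli_weight p C (\<lambda>E. X (E \<inter> D)) = bernoulli_weight p D X"
  using bernoulli_weight_split[OF assms, of p X "\<lambda>_. True"] assms(1)
  by (simp add: bernoulli_weight_True)

text \<open>Complements exchange \<open>p\<close> and \<open>1 - p\<close>; this turns independent
  sets into cliques.\<close>

lemma bernoulli_weight_complement:
  assumes "finite C"
  shows "bernoulli_weight p C (\<lambda>E. X (C - E)) = bernoulli_weight (1 - p) C X"
  unfolding bernoulli_weight_def
  by (rule sum.reindex_bij_witness[where i = "\<lambda>E. C - E" and j = "\<lambda>E. C - E"])
    (auto simp: double_diff mult.commute)

text \<open>An exponential Markov inequality: \<theta>^(|E| - r) is at least 1 on the event, and the
  mean of \<theta>^|E| is the first factor of the bound.\<close>

lemma bernoulli_weight_few: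
  assumes "finite D" "0 \<le> p" "p \<le> 1" "0 < \<theta>" "\<theta> \<le> 1"
  shows "bernoulli_weight p D (\<lambda>E. real (card E) \<le> r) \<le> (1 - p + p * \<theta>) ^ card D * \<theta> powr (- r)"
proof -
  have "bernoulli_weight p D (\<lambda>E. real (card E) \<le> r) \<le>
      (\<Sum>E | E \<subseteq> D \<and> real (card E) \<le> r.
        (p * \<theta>) ^ card E * (1 - p) ^ card (D - E) * \<theta> powr (- r))"
    unfolding bernoulli_weight_def
  proof (rule sum_mono)
    fix E assume "E \<in> {E. E \<subseteq> D \<and> real (card E) \<le> r}"
    then have "\<theta> powr r \<le> \<theta> powr card E"
      using assms by (intro powr_mono') auto
    then have "1 \<le> \<theta> ^ card E * \<theta> powr (- r)"
      using assms by (simp add: powr_minus field_simps powr_realpow)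
    then have "p ^ card E * (1 - p) ^ card (D - E) * 1 \<le>
        p ^ card E * (1 - p) ^ card (D - E) * (\<theta> ^ card E * \<theta> powr (- r))"
      using assms by (intro mult_left_mono) auto
    then show "p ^ card E * (1 - p) ^ card (D - E) \<le>
        (p * \<theta>) ^ card E * (1 - p) ^ card (D - E) * \<theta> powr (- r)"
      by (simp add: power_mult_distrib ac_simps)
  qed
  also have "\<dots> \<le> (\<Sum>E \<in> Pow D.
        (p * \<theta>) ^ card E * (1 - p) ^ card (D - E) * \<theta> powr (- r))"
    using assms by (intro sum_mono2) auto
  also have "\<dots> = (1 - p + p * \<theta>) ^ card D * \<theta> powr (- r)"
    by (simp add: sum_distrib_right[symmetric] sum_Pow_powers[OF assms(1)] add.commute)
  finally show ?thesis .
qed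

lemma clique_free_subset: "clique_free s V E \<Longrightarrow> E' \<subseteq> E \<Longrightarrow> clique_free s V E'"
  unfolding clique_free_def by blast

text \<open>By \<open>cher\<close>, a fixed \<open>D\<close> of \<open>d\<close> pairs is sparse
  with probability at most (1 - p)^(19d/20). By \<open>few\<close>, at most (1 - p)^(-d/20) choices
  of \<open>U\<close> and \<open>P\<close> compete. Hence a round that removes \<open>D\<close>
  gains (1 - p)^(9d/10), and rounds continue while more than \<open>M\<close> pairs are
  left.\<close>

lemma bernoulli_weight_clique_free:
  fixes p \<epsilon> \<beta> \<theta> M :: real
  assumes fin: "finite V" and s: "0 < s" and p: "0 < p" "p < 1"
    and eps: "0 < \<epsilon>" "\<epsilon> \<le> 1" and beta: "\<beta> > 0" and theta: "0 < \<theta>" "\<theta> \<le> 1"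
    and rich: "\<And>C. C \<subseteq> [V]\<^bsup>2\<^esup> \<Longrightarrow> M < card C \<Longrightarrow> \<exists>W \<subseteq> V. \<forall>P \<subseteq> W.
      [P]\<^bsup>2\<^esup> \<subseteq> C \<longrightarrow> card P < s \<longrightarrow> \<beta> \<le> card (common_nbs C P W)"
    and cher: "(1 - p + p * \<theta>) * \<theta> powr (- 2 * \<epsilon>) \<le> (1 - p) powr (19 / 20)"
    and few: "\<And>d. (\<epsilon> ^ s * \<beta>)\<^sup>2 \<le> 2 * real d \<Longrightarrow>
      2 ^ card V * real (card {P. P \<subseteq> V \<and> card P < s}) ^ card V * (1 - p) powr (d / 20) \<le> 1"
    and C: "C \<subseteq> [V]\<^bsup>2\<^esup>"
  shows "bernoulli_weight p C (clique_free s V) \<le> (1 - p) powr (9 / 10 * (card C - M))"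
  using C
proof (induction "card C" arbitrary: C rule: less_induct)
  case less
  define q where "q = 1 - p"
  have q: "0 < q" "q < 1" using p by (auto simp: q_def)
  have finC: "finite C"
    using less.prems finite_imp_finite_nsets[OF fin] finite_subset by blast
  show ?case
  proof (cases "M < card C")
    \<comment> \<open>At or below the threshold the exponent is at most 0, so the claimed bound is
      at least 1.\<close>
    case False
    then have "1 \<le> (1 - p) powr (9 / 10 * (card C - M))"
      using p powr_mono'[of "9 / 10 * (card C - M)" 0 "1 - p"] by simp
    then show ?thesis
      using bernoulli_weight_le_1[OF finC, of p "clique_free s V"] p by linarith
  next
    case True
    then obtain W where W: "W \<subseteq> V"
      "\<And>P. P \<subseteq> W \<Longrightarrow> [P]\<^bsup>2\<^esup> \<subseteq> C \<Longrightarrow> card P < s \<Longrightarrow> \<beta> \<le> card (common_nbs C P W)"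
      using rich[OF less.prems] by blast
    define Small where "Small = {P. P \<subseteq> V \<and> card P < s}"
    define D where "D = (\<lambda>(U, P). link_pairs C U P)"
    \<comment> \<open>Witness functions are taken extensional on \<open>V\<close> to make the index
      set finite; outside \<open>U\<close> they get the default value \<open>{}\<close>, a member of
      \<open>Small\<close> because \<open>s\<close> is positive.\<close>
    define I where "I = {\<phi> \<in> Pow V \<times> (V \<rightarrow>\<^sub>E Small). (\<epsilon> ^ s * \<beta>)\<^sup>2 \<le> 2 * real (card (D \<phi>))}"
    have finSmall: "finite Small"
      using fin by (simp add: Small_def)
    have "{} \<in> Small" using s by (simp add: Small_def)
    then have Small0: "0 < card Small" using finSmall card_gt_0_iff by blast
    have finI': "finite (Pow V \<times> (V \<rightarrow>\<^sub>E Small))"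
      using fin finSmall by (intro finite_cartesian_product finite_PiE) auto
    then have finI: "finite I"
      by (simp add: I_def)
    have DC: "D \<phi> \<subseteq> C" for \<phi>
      by (cases \<phi>) (simp add: D_def link_pairs_subset)
    have finD: "finite (D \<phi>)" for \<phi>
      using DC finC finite_subset by blast
    have cardI: "real (card I) \<le> 2 ^ card V * real (card Small) ^ card V"
    proof -
      have "card I \<le> card (Pow V \<times> (V \<rightarrow>\<^sub>E Small))"
        unfolding I_def using finI' by (intro card_mono) auto
      also have "\<dots> = 2 ^ card V * card Small ^ card V"
        using fin by (simp add: card_cartesian_product card_Pow card_PiE)
      finally have "real (card I) \<le> real (2 ^ card V * card Small ^ card V)"
        unfolding of_nat_le_iff .
      then show ?thesis by simp
    qed
    have "bernoulli_weight p C (clique_free s V) \<le> (\<Sum>\<phi> \<in> I. bernoulli_weight p C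
        (\<lambda>E. real (card (E \<inter> D \<phi>)) \<le> 2 * \<epsilon> * card (D \<phi>) \<and> clique_free s V (E \<inter> (C - D \<phi>))))"
    proof (rule bernoulli_weight_union_bound[OF finC _ _ finI])
      fix E assume E: "E \<subseteq> C" "clique_free s V E"
      obtain U P where UP: "U \<subseteq> V" "\<And>v. v \<in> U \<Longrightarrow> P v \<subseteq> V \<and> card (P v) < s"
        "(\<epsilon> ^ s * \<beta>)\<^sup>2 \<le> 2 * card (link_pairs C U P)"
        "card (E \<inter> link_pairs C U P) \<le> 2 * \<epsilon> * card (link_pairs C U P)"
        using W(2) that by (rule sparse_link_pairs[OF fin less.prems E eps beta W(1)])
      define P' where "P' = (\<lambda>v \<in> V. if v \<in> U then P v else {})"
      have eq: "D (U, P') = link_pairs C U P"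
        using UP(1) unfolding D_def link_pairs_def P'_def by auto
      have "P' \<in> V \<rightarrow>\<^sub>E Small"
        using UP(2) s by (auto simp: P'_def Small_def)
      then have "(U, P') \<in> I"
        using UP(1,3) by (simp add: I_def eq)
      moreover have "clique_free s V (E \<inter> (C - D (U, P')))"
        using E(2) clique_free_subset by blast
      ultimately show "\<exists>\<phi> \<in> I. real (card (E \<inter> D \<phi>)) \<le> 2 * \<epsilon> * card (D \<phi>) \<and>
          clique_free s V (E \<inter> (C - D \<phi>))"
        using UP(4) eq by (intro bexI[of _ "(U, P')"]) auto
    qed (use p in auto)
    also have "\<dots> = (\<Sum>\<phi> \<in> I. bernoulli_weight p (D \<phi>) (\<lambda>E. real (card E) \<le> 2 * \<epsilon> * card (D \<phi>)) *
        bernoulli_weight p (C - D \<phi>) (clique_free s V))"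
      by (intro sum.cong refl bernoulli_weight_split[OF finC DC])
    also have "\<dots> \<le> (\<Sum>\<phi> \<in> I. q powr (9 / 10 * (card C - M)) / (2 ^ card V * real (card Small) ^ card V))"
    proof (rule sum_mono)
      fix \<phi> assume "\<phi> \<in> I"
      define d where "d = card (D \<phi>)"
      have d: "(\<epsilon> ^ s * \<beta>)\<^sup>2 \<le> 2 * real d"
        using \<open>\<phi> \<in> I\<close> by (simp add: I_def d_def)
      \<comment> \<open>Positivity of \<open>d\<close> makes \<open>C - D \<phi>\<close> strictly
        smaller than \<open>C\<close>, as the induction needs.\<close>
      then have d0: "0 < d"
        using eps beta by (cases d) (auto simp: not_le)
      have dC: "card (C - D \<phi>) = card C - d" "d \<le> card C"
        using DC finC finD by (auto simp: d_def card_Diff_subset card_mono)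
      have "bernoulli_weight p (D \<phi>) (\<lambda>E. real (card E) \<le> 2 * \<epsilon> * card (D \<phi>)) \<le>
          (1 - p + p * \<theta>) ^ d * \<theta> powr (- (2 * \<epsilon> * d))"
        unfolding d_def using p theta finD by (intro bernoulli_weight_few) auto
      also have "\<dots> = ((1 - p + p * \<theta>) * \<theta> powr (- 2 * \<epsilon>)) ^ d"
        using theta by (simp add: power_mult_distrib powr_power ac_simps)
      also have "\<dots> \<le> (q powr (19 / 20)) ^ d"
        unfolding q_def using p theta cher by (intro power_mono mult_nonneg_nonneg) auto
      also have "\<dots> = q powr (19 / 20 * d)"
        using q by (simp add: powr_power ac_simps)
      finally have 1: "bernoulli_weight p (D \<phi>) (\<lambda>E. real (card E) \<le> 2 * \<epsilon> * card (D \<phi>)) \<le>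
          q powr (19 / 20 * d)" .
      have "bernoulli_weight p (C - D \<phi>) (clique_free s V) \<le>
          (1 - p) powr (9 / 10 * (card (C - D \<phi>) - M))"
        using d0 dC less.prems by (intro less.hyps) auto
      also have "\<dots> = q powr (9 / 10 * (real (card C) - d - M))"
        using dC by (simp add: q_def of_nat_diff)
      finally have 2: "bernoulli_weight p (C - D \<phi>) (clique_free s V) \<le>
          q powr (9 / 10 * (real (card C) - d - M))" .
      have "bernoulli_weight p (D \<phi>) (\<lambda>E. real (card E) \<le> 2 * \<epsilon> * card (D \<phi>)) *
          bernoulli_weight p (C - D \<phi>) (clique_free s V) \<le>
          q powr (19 / 20 * d) * q powr (9 / 10 * (real (card C) - d - M))"
        using p by (intro mult_mono 1 2 bernoulli_weight_nonneg) auto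
      \<comment> \<open>The surplus 19/20 - 9/10 = 1/20 of the exponent pays for the number of
        indices.\<close>
      also have "\<dots> = q powr (d / 20) * q powr (9 / 10 * (card C - M))"
        by (simp add: powr_add[symmetric] field_simps)
      also have "\<dots> \<le> 1 / (2 ^ card V * real (card Small) ^ card V) * q powr (9 / 10 * (card C - M))"
      proof (rule mult_right_mono)
        show "q powr (d / 20) \<le> 1 / (2 ^ card V * real (card Small) ^ card V)"
          using few[OF d] Small0 unfolding q_def[symmetric] Small_def[symmetric] by (simp add: field_simps)
      qed simp
      finally show "bernoulli_weight p (D \<phi>) (\<lambda>E. real (card E) \<le> 2 * \<epsilon> * card (D \<phi>)) *
          bernoulli_weight p (C - D \<phi>) (clique_free s V) \<le>
          q powr (9 / 10 * (card C - M)) / (2 ^ card V * real (card Small) ^ card V)" by simp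
    qed
    also have "\<dots> = real (card I) / (2 ^ card V * real (card Small) ^ card V) *
        q powr (9 / 10 * (card C - M))"
      by simp
    also have "\<dots> \<le> 1 * q powr (9 / 10 * (card C - M))"
      using cardI Small0 by (intro mult_right_mono) (auto simp: divide_le_eq_1)
    finally show ?thesis by (simp add: q_def)
  qed
qed

subsection \<open>Clique-free random graphs\<close>

text \<open>\<open>W\<close> keeps the vertices with at most n/(2s) missing pairs; double counting
  leaves at least 5n/9 of them. Fewer than \<open>s\<close> such vertices exclude at most n/2 others
  besides themselves, and 5/9 - 1/2 - 1/180 = 1/20.\<close>

lemma rich_of_dense:
  fixes V :: "'a set"
  assumes fin: "finite V" and s: "0 < s" "180 * s \<le> card V" and CV: "C \<subseteq> [V]\<^bsup>2\<^esup>"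
    and dense: "real (card ([V]\<^bsup>2\<^esup>)) - (card V)\<^sup>2 / (9 * real s) < card C"
  obtains W where "W \<subseteq> V"
    "\<And>P. P \<subseteq> W \<Longrightarrow> card P < s \<Longrightarrow> card V / 20 \<le> card (common_nbs C P W)"
proof -
  define n where "n = real (card V)"
  have n: "0 < n" "180 * s \<le> n" using s by (auto simp: n_def)
  define N where "N v = {y \<in> V. {v, y} \<in> [V]\<^bsup>2\<^esup> - C}" for v
  define W where "W = {v \<in> V. card (N v) \<le> n / (2 * s)}"
  have finN: "finite (N v)" and finW: "finite W" for v
    using fin by (auto simp: N_def W_def)
  have fin2: "finite ([V]\<^bsup>2\<^esup>)" by (rule finite_imp_finite_nsets[OF fin])
  define R where "R = (SIGMA v : V. N v)"
  have finR: "finite R" using fin finN by (simp add: R_def)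
  have "(\<lambda>(v, y). {v, y}) ` R \<subseteq> [V]\<^bsup>2\<^esup> - C"
    by (auto simp: R_def N_def)
  then have "card R \<le> 2 * card ([V]\<^bsup>2\<^esup> - C)"
    using card_doubletons_le[OF finR] card_mono[of "[V]\<^bsup>2\<^esup> - C" "(\<lambda>(v, y). {v, y}) ` R"] fin2
    by simp
  also have "card ([V]\<^bsup>2\<^esup> - C) = card ([V]\<^bsup>2\<^esup>) - card C"
    using CV fin2 by (intro card_Diff_subset) (auto intro: finite_subset)
  finally have R: "real (card R) < 2 * (n\<^sup>2 / (9 * s))"
    using dense card_mono[OF fin2 CV] by (simp add: n_def)
  have "card (V - W) * (n / (2 * s)) = (\<Sum>v \<in> V - W. n / (2 * s))" by simp
  also have "\<dots> \<le> (\<Sum>v \<in> V - W. real (card (N v)))"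
    by (intro sum_mono) (auto simp: W_def)
  also have "\<dots> \<le> (\<Sum>v \<in> V. real (card (N v)))"
    using fin by (intro sum_mono2) auto
  also have "\<dots> = card R"
    unfolding R_def using fin finN by (subst card_SigmaI) auto
  finally have "card (V - W) * (n / (2 * s)) < 2 * (n\<^sup>2 / (9 * s))" using R by linarith
  then have "card (V - W) < 4 * n / 9"
    using n s by (simp add: field_simps power2_eq_square)
  moreover have "real (card (V - W)) = n - card W"
    using fin finW card_mono[OF fin, of W]
    by (simp add: n_def W_def card_Diff_subset of_nat_diff)
  ultimately have Wbig: "5 * n / 9 \<le> card W" by linarith
  show thesis
  proof
    show "W \<subseteq> V" by (auto simp: W_def)
    fix P assume P: "P \<subseteq> W" "card P < s"
    then have finP: "finite P" using finW finite_subset by blast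
    have "W \<subseteq> common_nbs C P W \<union> (P \<union> (\<Union>x \<in> P. N x))"
      using P by (auto simp: common_nbs_def N_def W_def)
    then have "card W \<le> card (common_nbs C P W \<union> (P \<union> (\<Union>x \<in> P. N x)))"
      using finW finP finN by (intro card_mono) (auto simp: common_nbs_def)
    also have "\<dots> \<le> card (common_nbs C P W) + (card P + card (\<Union>x \<in> P. N x))"
      by (meson add_left_mono card_Un_le le_trans)
    finally have 1: "real (card W) \<le> card (common_nbs C P W) + (real (card P) + card (\<Union>x \<in> P. N x))"
      by linarith
    have "card (\<Union>x \<in> P. N x) \<le> (\<Sum>x \<in> P. card (N x))"
      by (rule card_UN_le[OF finP])
    then have "real (card (\<Union>x \<in> P. N x)) \<le> (\<Sum>x \<in> P. real (card (N x)))"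
      by (metis of_nat_le_iff of_nat_sum)
    also have "\<dots> \<le> (\<Sum>x \<in> P. n / (2 * s))"
      using P by (intro sum_mono) (auto simp: W_def)
    also have "\<dots> = card P * (n / (2 * s))" by simp
    also have "\<dots> \<le> s * (n / (2 * s))"
      using P n by (intro mult_right_mono) auto
    also have "\<dots> = n / 2" using s by simp
    finally have "real (card (\<Union>x \<in> P. N x)) \<le> n / 2" .
    then show "card V / 20 \<le> card (common_nbs C P W)"
      using 1 Wbig P n unfolding n_def[symmetric] by linarith
  qed
qed

lemma card_small_subsets_le:
  assumes fin: "finite V" and "2 \<le> card V"
  shows "card {P. P \<subseteq> V \<and> card P < s} \<le> card V ^ s"
proof -
  have "{P. P \<subseteq> V \<and> card P < s} = (\<Union>i < s. {P. P \<subseteq> V \<and> card P = i})" by auto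
  then have "card {P. P \<subseteq> V \<and> card P < s} \<le> (\<Sum>i < s. card {P. P \<subseteq> V \<and> card P = i})"
    by (simp add: card_UN_le)
  also have "\<dots> = (\<Sum>i < s. card V choose i)"
    using n_subsets[OF fin] by simp
  also have "\<dots> \<le> (\<Sum>i < s. card V ^ i)"
  proof (rule sum_mono)
    fix i
    show "card V choose i \<le> card V ^ i"
      by (cases "i \<le> card V") (auto simp: binomial_le_pow binomial_eq_0)
  qed
  also have "\<dots> \<le> card V ^ s"
  proof (induction s)
    case (Suc s)
    have "2 * card V ^ s \<le> card V * card V ^ s"
      using assms(2) by (rule mult_le_mono1)
    then show ?case unfolding sum.lessThan_Suc power_Suc using Suc by linarith
  qed simp
  finally show ?thesis .
qed

text \<open>The condition \<open>cher\<close> for \<epsilon> = 1/L^2 and \<theta> = 1/L^3. As q = 1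
  - p is at least 1/L, the left side exceeds q by a factor of at most exp((1 + 6 ln L)/L^2). This is
  at most exp(1/(20L)), hence at most q^(-1/20), because -ln q is at least p.\<close>

lemma sparse_factor_le:
  fixes p L :: real
  assumes p: "1 / L \<le> p" "p \<le> 1 - 1 / L" and L: "1 \<le> L" "20 * (1 + 6 * ln L) \<le> L"
  shows "(1 - p + p * (1 / L ^ 3)) * (1 / L ^ 3) powr (- 2 * (1 / L\<^sup>2)) \<le> (1 - p) powr (19 / 20)"
proof -
  define q where "q = 1 - p"
  have L0: "0 < 1 / L" using L by simp
  have q: "1 / L \<le> q" "q \<le> 1 - 1 / L" using p by (auto simp: q_def)
  have q0: "0 < q" using q L0 by linarith
  have "1 / L \<le> - ln q"
    using ln_le_minus_one[OF q0] q by linarith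
  have "p * (1 / L ^ 3) \<le> 1 * (1 / L ^ 3)"
    using p(2) L0 L(1) by (intro mult_right_mono) (linarith, simp)
  also have "\<dots> = 1 / L * (1 / L\<^sup>2)"
    by (simp add: power2_eq_square power3_eq_cube)
  also have "\<dots> \<le> q * (1 / L\<^sup>2)"
    using q L by (intro mult_right_mono) auto
  finally have "q + p * (1 / L ^ 3) \<le> q * (1 + 1 / L\<^sup>2)" by (simp add: algebra_simps)
  also have "\<dots> \<le> q * exp (1 / L\<^sup>2)"
    using q0 by (intro mult_left_mono exp_ge_add_one_self) auto
  finally have 1: "q + p * (1 / L ^ 3) \<le> q * exp (1 / L\<^sup>2)" .
  have "ln (1 / L ^ 3) = - 3 * ln L"
    using L by (simp add: ln_div ln_realpow)
  then have 2: "(1 / L ^ 3) powr (- 2 * (1 / L\<^sup>2)) = exp (6 * ln L / L\<^sup>2)"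
    using L by (simp add: powr_def)
  have "(q + p * (1 / L ^ 3)) * (1 / L ^ 3) powr (- 2 * (1 / L\<^sup>2)) \<le>
      q * exp (1 / L\<^sup>2) * exp (6 * ln L / L\<^sup>2)"
    unfolding 2 using 1 by (intro mult_right_mono) auto
  also have "\<dots> = exp (ln q + (1 + 6 * ln L) / L\<^sup>2)"
    using q0 by (simp add: exp_add add_divide_distrib)
  also have "\<dots> \<le> exp (19 / 20 * ln q)"
  proof -
    have "(1 + 6 * ln L) / L\<^sup>2 \<le> (L / 20) / L\<^sup>2"
      using L by (intro divide_right_mono) auto
    also have "\<dots> = 1 / L / 20"
      using L by (simp add: power2_eq_square)
    also have "\<dots> \<le> - ln q / 20" using \<open>1 / L \<le> - ln q\<close> by simp
    finally have "ln q + (1 + 6 * ln L) / L\<^sup>2 \<le> 19 / 20 * ln q" by linarith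
    then show ?thesis by (simp only: exp_le_cancel_iff)
  qed
  also have "\<dots> = q powr (19 / 20)"
    using q0 by (simp add: powr_def)
  finally show ?thesis by (simp add: q_def)
qed

text \<open>The condition \<open>few\<close>. The constant 120 gives L^s \<le> n^(1/120), so
  \<open>d\<close> is at least n^(59/30)/800 with 59/30 = 2 - 4/120. Then q^(d/20) \<le>
  exp(-d/(20L)) outweighs the count, which is at most exp(n(1 + L^2)); note 16000 = 800 *
  20.\<close>

lemma few_witnesses:
  fixes n L q :: real
  assumes n: "n = real m" "2 \<le> m" and L: "L = log 2 n" "4 \<le> L"
    and s: "real s \<le> L / (120 * log 2 L)" and q: "0 < q" "q \<le> 1 - 1 / L"
    and big: "n * (1 + L\<^sup>2) * 16000 * L \<le> n powr (59 / 30)"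
    and d: "((1 / L\<^sup>2) ^ s * (n / 20))\<^sup>2 \<le> 2 * real d"
  shows "2 ^ m * (n ^ s) ^ m * q powr (d / 20) \<le> 1"
proof -
  have n0: "0 < n" using n by simp
  have nL: "n = 2 powr L" using n0 L by simp
  have "log 2 2 \<le> log 2 L" using L by (subst log_le_cancel_iff) auto
  then have lL: "1 \<le> log 2 L" by simp
  have sl: "s * log 2 L \<le> L / 120"
    using s lL by (simp add: field_simps)
  have "real s * 1 \<le> s * log 2 L" using lL by (intro mult_left_mono) auto
  then have sL: "real s \<le> L" using sl L by linarith
  have Ls: "L ^ s \<le> n powr (1 / 120)"
  proof -
    have "L ^ s = (2 powr log 2 L) ^ s" using L(2) by simp
    also have "\<dots> = 2 powr (s * log 2 L)" by (simp only: powr_power mult.commute)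
    also have "\<dots> \<le> 2 powr (L / 120)" using sl by simp
    also have "\<dots> = n powr (1 / 120)" unfolding nL by (simp add: powr_powr)
    finally show ?thesis .
  qed
  have "n powr (59 / 30) = n\<^sup>2 / (n powr (1 / 120)) ^ 4"
  proof -
    have "n\<^sup>2 = n powr 2" using n0 by simp
    moreover have "(n powr (1 / 120)) ^ 4 = n powr (1 / 30)" using n0 by (simp add: powr_power)
    ultimately show ?thesis by (simp add: powr_diff[symmetric])
  qed
  also have "\<dots> \<le> n\<^sup>2 / (L ^ s) ^ 4"
    using Ls L(2) n0 by (intro divide_left_mono power_mono) auto
  also have "\<dots> = 400 * ((1 / L\<^sup>2) ^ s * (n / 20))\<^sup>2"
    by (simp add: power_divide power_mult_distrib power_mult[symmetric] mult.commute)
  also have "\<dots> \<le> 800 * d" using d by simp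
  finally have "n * (1 + L\<^sup>2) * 16000 * L \<le> 800 * d" using big by linarith
  then have dbig: "n * (1 + L\<^sup>2) \<le> d / 20 / L"
    using L by (simp add: field_simps)
  have "2 ^ m * (n ^ s) ^ m = 2 powr (n * (1 + s * L))"
  proof -
    have "(n ^ s) ^ m = 2 powr (L * (s * n))"
      unfolding n(1)[symmetric] using n0 n L(1) by (simp add: powr_powr[symmetric] powr_realpow power_mult[symmetric] flip: of_nat_mult)
    moreover have "(2::real) ^ m = 2 powr n" using n by (simp add: powr_realpow)
    ultimately show ?thesis by (simp add: powr_add[symmetric] algebra_simps)
  qed
  also have "\<dots> \<le> 2 powr (n * (1 + L\<^sup>2))"
  proof -
    have "s * L \<le> L * L" using sL L(2) by (intro mult_right_mono) auto
    then show ?thesis using n0 by (simp add: power2_eq_square)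
  qed
  also have "\<dots> \<le> exp 1 powr (n * (1 + L\<^sup>2))"
    using n0 exp_ge_add_one_self[of 1] by (intro powr_mono2) auto
  also have "\<dots> = exp (n * (1 + L\<^sup>2))" by (simp add: powr_def)
  finally have 1: "2 ^ m * (n ^ s) ^ m \<le> exp (n * (1 + L\<^sup>2))" .
  have "ln q \<le> - (1 / L)"
    using ln_le_minus_one[OF q(1)] q by linarith
  then have "q powr (d / 20) \<le> exp (- (d / 20 / L))"
    using q mult_left_mono[of "ln q" "- (1 / L)" "d / 20"] by (simp add: powr_def)
  then have "2 ^ m * (n ^ s) ^ m * q powr (d / 20) \<le> exp (n * (1 + L\<^sup>2)) * exp (- (d / 20 / L))"
    using 1 n0 by (intro mult_mono) auto
  also have "\<dots> \<le> 1" using dbig by (simp flip: exp_add)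
  finally show ?thesis .
qed

text \<open>The induction is started with all pairs and with \<open>?M\<close> lying n^2/(9s) below
  their number, so the exponent is 9/10 * n^2/(9s) = n^2/(10s). The asymptotic inequalities involve
  \<open>n\<close> alone, which makes the result uniform in \<open>V\<close>, \<open>s\<close> and
  \<open>p\<close>.\<close>

lemma clique_free_unlikely:
  "\<forall>\<^sub>F n in sequentially. \<forall>(V :: 'a set) s p. card V = n \<longrightarrow> 0 < s \<longrightarrow>
    real s \<le> log 2 n / (120 * log 2 (log 2 n)) \<longrightarrow> 1 / log 2 n \<le> p \<longrightarrow> p \<le> 1 - 1 / log 2 n \<longrightarrow>
    bernoulli_weight p ([V]\<^bsup>2\<^esup>) (clique_free s V) \<le> (1 - p) powr ((real n)\<^sup>2 / (10 * real s))"
proof -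
  have "\<forall>\<^sub>F n in sequentially. 4 \<le> log 2 (real n)" by real_asymp
  moreover have "\<forall>\<^sub>F n in sequentially. 20 * (1 + 6 * ln (log 2 (real n))) \<le> log 2 (real n)"
    by real_asymp
  moreover have "\<forall>\<^sub>F n in sequentially.
      real n * (1 + (log 2 (real n))\<^sup>2) * 16000 * log 2 (real n) \<le> real n powr (59 / 30)"
    by real_asymp
  moreover have "\<forall>\<^sub>F n in sequentially. 180 * log 2 (real n) \<le> real n" by real_asymp
  moreover have "\<forall>\<^sub>F n :: nat in sequentially. 2 \<le> n" by (rule eventually_ge_at_top)
  ultimately show ?thesis
  proof eventually_elim
    case (elim n)
    show ?case
    proof (intro allI impI)
      fix V :: "'a set" and s :: nat and p :: real
      assume V: "card V = n" and s: "0 < s" "real s \<le> log 2 n / (120 * log 2 (log 2 n))"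
        and p: "1 / log 2 n \<le> p" "p \<le> 1 - 1 / log 2 n"
      define L where "L = log 2 (real n)"
      have L: "4 \<le> L" using elim by (simp add: L_def)
      have fin: "finite V" using V elim by (intro card_ge_0_finite) auto
      have "120 * real s \<le> L" using L s(2) by (intro mult_120_le) (auto simp: L_def)
      then have "real s \<le> L" by linarith
      then have s180: "180 * s \<le> card V" using elim V by (simp add: L_def)
      have Linv: "0 < 1 / L" "1 / L \<le> 1" using L by auto
      then have p01: "0 < p" "p < 1" using p unfolding L_def by linarith+
      let ?M = "real (card ([V]\<^bsup>2\<^esup>)) - (card V)\<^sup>2 / (9 * real s)"
      have "bernoulli_weight p ([V]\<^bsup>2\<^esup>) (clique_free s V) \<le>
          (1 - p) powr (9 / 10 * (card ([V]\<^bsup>2\<^esup>) - ?M))"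
      proof (rule bernoulli_weight_clique_free[where \<epsilon> = "1 / L\<^sup>2" and \<beta> = "card V / 20" and
            \<theta> = "1 / L ^ 3", OF fin s(1) p01])
        fix C assume C: "C \<subseteq> [V]\<^bsup>2\<^esup>" "?M < card C"
        show "\<exists>W\<subseteq>V. \<forall>P\<subseteq>W. [P]\<^bsup>2\<^esup> \<subseteq> C \<longrightarrow> card P < s \<longrightarrow> card V / 20 \<le> card (common_nbs C P W)"
          using rich_of_dense[OF fin s(1) s180 C] by metis
      next
        show "(1 - p + p * (1 / L ^ 3)) * (1 / L ^ 3) powr (- 2 * (1 / L\<^sup>2)) \<le> (1 - p) powr (19 / 20)"
          using p elim L unfolding L_def by (intro sparse_factor_le) auto
      next
        fix d assume d: "((1 / L\<^sup>2) ^ s * (real (card V) / 20))\<^sup>2 \<le> 2 * real d"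
        have "2 ^ n * real (card {P. P \<subseteq> V \<and> card P < s}) ^ n * (1 - p) powr (d / 20) \<le>
            2 ^ n * (real n ^ s) ^ n * (1 - p) powr (d / 20)"
          using card_small_subsets_le[OF fin, of s] elim V
          by (intro mult_right_mono mult_left_mono power_mono) (auto simp flip: of_nat_power)
        also have "\<dots> \<le> 1"
          using few_witnesses[of n n L s "1 - p" d] elim L s p p01 d V unfolding L_def by simp
        finally show "2 ^ card V * real (card {P. P \<subseteq> V \<and> card P < s}) ^ card V *
            (1 - p) powr (d / 20) \<le> 1" using V by simp
      qed (use L Linv elim V in \<open>auto simp: power_le_one\<close>)
      then show "bernoulli_weight p ([V]\<^bsup>2\<^esup>) (clique_free s V) \<le> (1 - p) powr ((real n)\<^sup>2 / (10 * real s))"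
        by (simp add: V)
    qed
  qed
qed

subsection \<open>Lower bound\<close>

text \<open>Colour a set blue exactly when it contains an \<open>s\<close>-clique. An
  \<open>s\<close>-clique in \<open>A\<close> then lies in no red set. An independent
  \<open>t\<close>-set meets every \<open>s\<close>-clique in at most one point, so together they
  have at least s + t - 1 vertices, one too many for a blue \<open>k\<close>-set.\<close>

lemma not_cover_ramsey_of_graph:
  assumes "2 \<le> s" "2 \<le> t"
    and good: "\<And>A. A \<in> [{1..N}]\<^bsup>n\<^esup> \<Longrightarrow>
      \<not> clique_free s A E \<and> \<not> clique_free t A ([{1..N}]\<^bsup>2\<^esup> - E)"
  shows "\<not> cover_ramsey (s + t - 2) n s t N"
proof
  assume "cover_ramsey (s + t - 2) n s t N"
  define \<chi> where "\<chi> K = (if \<exists>S \<in> [K]\<^bsup>s\<^esup>. [S]\<^bsup>2\<^esup> \<subseteq> E then Blue else Red)" for K :: "nat set"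
  obtain A where A: "A \<in> [{1..N}]\<^bsup>n\<^esup>"
    and cov: "covered \<chi> Red (s + t - 2) N s A \<or> covered \<chi> Blue (s + t - 2) N t A"
    using \<open>cover_ramsey (s + t - 2) n s t N\<close> unfolding cover_ramsey_def by blast
  obtain S where S: "S \<in> [A]\<^bsup>s\<^esup>" "[S]\<^bsup>2\<^esup> \<subseteq> E"
    using good[OF A] unfolding clique_free_def by blast
  obtain T where T: "T \<in> [A]\<^bsup>t\<^esup>" "[T]\<^bsup>2\<^esup> \<inter> E = {}"
    using good[OF A] unfolding clique_free_def by blast
  show False
    using cov
  proof
    assume "covered \<chi> Red (s + t - 2) N s A"
    then obtain K where "S \<subseteq> K" "\<chi> K = Red"
      using S(1) unfolding covered_def by blast
    moreover have "S \<in> [K]\<^bsup>s\<^esup>" using S(1) \<open>S \<subseteq> K\<close> by (auto simp: nsets_def)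
    ultimately have "\<chi> K = Blue" using S(2) unfolding \<chi>_def by (metis (full_types))
    then show False using \<open>\<chi> K = Red\<close> by simp
  next
    assume "covered \<chi> Blue (s + t - 2) N t A"
    then obtain K where K: "K \<in> [{1..N}]\<^bsup>(s + t - 2)\<^esup>" "T \<subseteq> K" "\<chi> K = Blue"
      using T(1) unfolding covered_def by blast
    then obtain S' where S': "S' \<in> [K]\<^bsup>s\<^esup>" "[S']\<^bsup>2\<^esup> \<subseteq> E"
      by (auto simp: \<chi>_def split: if_splits)
    have fin: "finite S'" "finite T" "card S' = s" "card T = t" "finite K" "card K = s + t - 2"
      using S'(1) T(1) K(1) by (auto simp: nsets_def)
    have "card (T \<inter> S') \<le> 1"
      by (rule card_Int_homogeneous[OF fin(1) S'(2) T(2)])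
    moreover have "card (S' \<union> T) \<le> card K"
      using S'(1) K(2) fin by (intro card_mono) (auto simp: nsets_def)
    ultimately show False
      using card_Un_Int[OF fin(1,2)] fin assms(1,2) by (simp add: Int_commute)
  qed
qed

lemma clique_free_Int: "clique_free s A (E \<inter> [A]\<^bsup>2\<^esup>) \<longleftrightarrow> clique_free s A E"
proof -
  have "[S]\<^bsup>2\<^esup> \<subseteq> [A]\<^bsup>2\<^esup>" if "S \<in> [A]\<^bsup>s\<^esup>" for S
    using that by (intro nsets_mono) (simp add: nsets_def)
  then show ?thesis unfolding clique_free_def by blast
qed

lemma exists_good_graph:
  fixes p \<delta> :: real and V :: "'a set"
  assumes fin: "finite V" and p: "0 \<le> p" "p \<le> 1"
    and s: "\<And>A. A \<in> [V]\<^bsup>n\<^esup> \<Longrightarrow> bernoulli_weight p ([A]\<^bsup>2\<^esup>) (clique_free s A) \<le> \<delta>"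
    and t: "\<And>A. A \<in> [V]\<^bsup>n\<^esup> \<Longrightarrow> bernoulli_weight (1 - p) ([A]\<^bsup>2\<^esup>) (clique_free t A) \<le> \<delta>"
    and \<delta>: "0 \<le> \<delta>" "real (card V) ^ n * (2 * \<delta>) < 1"
  obtains E where "\<And>A. A \<in> [V]\<^bsup>n\<^esup> \<Longrightarrow> \<not> clique_free s A E \<and> \<not> clique_free t A ([V]\<^bsup>2\<^esup> - E)"
proof (rule ccontr)
  assume "\<not> thesis"
  then have bad: "\<exists>A \<in> [V]\<^bsup>n\<^esup>. clique_free s A E \<or> clique_free t A ([V]\<^bsup>2\<^esup> - E)" for E
    using that by blast
  have finV: "finite ([V]\<^bsup>k\<^esup>)" for k by (rule finite_imp_finite_nsets[OF fin])
  define Y where "Y = (\<lambda>(A :: 'a set, b) E. if b then clique_free s A (E \<inter> [A]\<^bsup>2\<^esup>)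
      else clique_free t A ([A]\<^bsup>2\<^esup> - E \<inter> [A]\<^bsup>2\<^esup>))"
  let ?I = "[V]\<^bsup>n\<^esup> \<times> (UNIV :: bool set)"
  have "1 = bernoulli_weight p ([V]\<^bsup>2\<^esup>) (\<lambda>_. True)"
    by (simp add: bernoulli_weight_True finV)
  also have "\<dots> \<le> (\<Sum>i \<in> ?I. bernoulli_weight p ([V]\<^bsup>2\<^esup>) (Y i))"
  proof (rule bernoulli_weight_union_bound[OF finV p])
    fix E
    obtain A where A: "A \<in> [V]\<^bsup>n\<^esup>" "clique_free s A E \<or> clique_free t A ([V]\<^bsup>2\<^esup> - E)"
      using bad by blast
    have "[A]\<^bsup>2\<^esup> - E \<inter> [A]\<^bsup>2\<^esup> = ([V]\<^bsup>2\<^esup> - E) \<inter> [A]\<^bsup>2\<^esup>"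
      using A(1) nsets_mono[of A V 2] by (auto simp: nsets_def)
    then have "Y (A, True) E \<or> Y (A, False) E"
      using A(2) by (simp add: Y_def clique_free_Int)
    then show "\<exists>i \<in> ?I. Y i E" using A(1) by blast
  qed (use finV in auto)
  also have "\<dots> \<le> (\<Sum>i \<in> ?I. \<delta>)"
  proof (rule sum_mono)
    fix i assume "i \<in> ?I"
    then obtain A b where i: "i = (A, b)" "A \<in> [V]\<^bsup>n\<^esup>" by auto
    then have sub: "[A]\<^bsup>2\<^esup> \<subseteq> [V]\<^bsup>2\<^esup>" by (intro nsets_mono) (auto simp: nsets_def)
    then have finA: "finite ([A]\<^bsup>2\<^esup>)" using finV finite_subset by blast
    show "bernoulli_weight p ([V]\<^bsup>2\<^esup>) (Y i) \<le> \<delta>"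
    proof (cases b)
      case True
      then show ?thesis
        using s[OF i(2)] bernoulli_weight_restrict[OF finV sub, of p "clique_free s A"]
        by (simp add: i Y_def)
    next
      case False
      then show ?thesis
        using t[OF i(2)] bernoulli_weight_restrict[OF finV sub, of p "\<lambda>E. clique_free t A ([A]\<^bsup>2\<^esup> - E)"]
          bernoulli_weight_complement[OF finA, of p "clique_free t A"]
        by (simp add: i Y_def)
    qed
  qed
  also have "\<dots> = (card V choose n) * (2 * \<delta>)"
    using n_subsets[OF fin, of n] fin finite_subset[of _ V]
    by (simp add: card_cartesian_product nsets_def conj_commute cong: conj_cong)
  also have "\<dots> \<le> real (card V) ^ n * (2 * \<delta>)"
  proof (rule mult_right_mono)
    have "card V choose n \<le> card V ^ n"
      by (cases "n \<le> card V") (auto simp: binomial_le_pow binomial_eq_0)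
    then show "real (card V choose n) \<le> real (card V) ^ n"
      by (simp flip: of_nat_power)
  qed (use \<delta> in simp)
  finally show False using \<delta> by linarith
qed

text \<open>The last bound is \<open>e ln u \<le> u\<close> at \<open>u = y\<^sup>2\<^sup>/\<^sup>3\<close>.\<close>

lemma edge_density_bounds:
  fixes y x :: real
  assumes y: "y = 2 * exp 1 * x" and x: "1 \<le> x"
  shows "1 < y" "y powr (- 1 / 3) \<le> 3 / 4" "ln y / (3 * x) \<le> y powr (- 1 / 3)"
proof -
  have "2 \<le> exp (1 :: real)" using exp_ge_add_one_self[of 1] by simp
  then have "4 * 1 \<le> 2 * exp 1 * x" using x by (intro mult_mono) auto
  then have y4: "4 \<le> y" by (simp add: y)
  then show "1 < y" by simp
  \<comment> \<open>Because (4/3)^3 = 64/27 is below 4.\<close>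
  have "4 / 3 = ((4 / 3) powr 3 :: real) powr (1 / 3)"
    by (simp only: powr_powr) simp
  also have "\<dots> \<le> y powr (1 / 3)"
    using y4 by (intro powr_mono2) (auto simp: power3_eq_cube)
  finally have "4 / 3 \<le> y powr (1 / 3)" .
  then show "y powr (- 1 / 3) \<le> 3 / 4"
    using y4 by (simp add: powr_minus field_simps)
  define u where "u = y powr (2 / 3)"
  have u: "0 < u" using y4 by (simp add: u_def)
  have "ln (u / exp 1) \<le> u / exp 1 - 1" using u by (intro ln_le_minus_one) simp
  then have "exp 1 * ln u \<le> u" using u by (simp add: ln_div field_simps)
  moreover have "ln u = 2 / 3 * ln y" using y4 by (simp add: u_def ln_powr)
  ultimately have "exp 1 * (2 / 3 * ln y) \<le> u" by simp
  moreover have "u = y * y powr (- 1 / 3)"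
    using y4 by (simp add: u_def powr_mult_base)
  ultimately show "ln y / (3 * x) \<le> y powr (- 1 / 3)"
    using x by (simp add: y field_simps)
qed

text \<open>The choice of \<open>p\<close> gives both failures of a fixed \<open>A\<close> the same
  bound \<delta> = y^(-n^2/(30t)): p^(n^2/(10t)) equals it, and exp(-p n^2/(10s)) is at most that by
  \<open>edge_density_bounds\<close>. There are at most N^n \<le> y^(n^2/(32t)) sets
  \<open>A\<close>, and 1/30 - 1/32 = 1/480 leaves a negative exponent.\<close>

lemma cover_ramsey_number_lower:
  "\<forall>\<^sub>F n in sequentially. \<forall>s t :: nat.
    2 \<le> s \<and> s \<le> t \<and> real t \<le> log 2 (real n) / (120 * log 2 (log 2 (real n))) \<longrightarrow>
      2 powr (real n / (32 * real t) * log 2 (2 * exp 1 * real t / real s))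
        \<le> real (cover_ramsey_number (s + t - 2) n s t)"
proof -
  have "\<forall>\<^sub>F n in sequentially. 4 \<le> log 2 (real n)" by real_asymp
  moreover have "\<forall>\<^sub>F n in sequentially. 480 * log 2 (real n) \<le> real n" by real_asymp
  moreover note clique_free_unlikely[where ?'a = nat]
  ultimately show ?thesis
  proof eventually_elim
    case (elim n)
    show ?case
    proof (intro allI impI, elim conjE)
      fix s t :: nat
      assume s: "2 \<le> s" and st: "s \<le> t"
        and t: "real t \<le> log 2 (real n) / (120 * log 2 (log 2 (real n)))"
      define L where "L = log 2 (real n)"
      have L: "4 \<le> L" "480 * L \<le> n" using elim by (auto simp: L_def)
      have tL: "120 * real t \<le> L" using L(1) t by (intro mult_120_le) (auto simp: L_def)
      have n0: "0 < n" using L by (cases n) auto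
      define x where "x = real t / real s"
      define y where "y = 2 * exp 1 * x"
      have x: "1 \<le> x" using s st by (simp add: x_def)
      define p where "p = y powr (- 1 / 3)"
      note y = edge_density_bounds[OF y_def x, folded p_def]
      \<comment> \<open>This yields \<open>1 / L \<le> p\<close>, the lower end of the range in
        \<open>clique_free_unlikely\<close>.\<close>
      have y3: "y \<le> L ^ 3"
      proof -
        have "exp 1 \<le> (3 :: real)" using exp_le by simp
        then have "2 * exp 1 * x \<le> 2 * 3 * real t"
          using s st by (intro mult_mono) (auto simp: x_def field_simps)
        also have "\<dots> \<le> L ^ 1" using tL by simp
        also have "\<dots> \<le> L ^ 3" using L by (intro power_increasing) auto
        finally show ?thesis by (simp add: y_def)
      qed
      have p1: "1 / L \<le> p"
      proof -
        have "y powr (1 / 3) \<le> (L powr 3) powr (1 / 3)"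
          using y y3 L by (intro powr_mono2) auto
        also have "\<dots> = L" unfolding powr_powr using L by simp
        finally show ?thesis using y L by (simp add: p_def powr_minus field_simps)
      qed
      have p2: "1 / L \<le> 1 - p"
      proof -
        have "1 / L \<le> 1 / 4" using L by (intro divide_left_mono) auto
        then show ?thesis using y by linarith
      qed
      have "0 < 1 / L" using L by simp
      then have p0: "0 < p" "p < 1" using p1 p2 by linarith+
      define \<delta> where "\<delta> = y powr (- ((real n)\<^sup>2 / (30 * t)))"
      have sL: "real s \<le> log 2 (real n) / (120 * log 2 (log 2 (real n)))"
        using st t by (meson of_nat_le_iff order_trans)
      show "2 powr (real n / (32 * real t) * log 2 (2 * exp 1 * real t / real s))
          \<le> real (cover_ramsey_number (s + t - 2) n s t)"
      proof (rule ccontr)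
        assume less: "\<not> ?thesis"
        define N where "N = cover_ramsey_number (s + t - 2) n s t"
        have y_eq: "2 * exp 1 * real t / real s = y" by (simp add: y_def x_def)
        have "2 powr (real n / (32 * real t) * log 2 y) = y powr (real n / (32 * t))"
          using y by (simp add: powr_def log_def)
        then have N: "real N \<le> y powr (real n / (32 * t))"
          using less by (simp add: N_def y_eq)
        have "real N ^ n * (2 * \<delta>) < 1"
        proof -
          have "real N ^ n \<le> (y powr (real n / (32 * t))) ^ n"
            using N by (intro power_mono) auto
          also have "\<dots> = y powr ((real n)\<^sup>2 / (32 * t))"
            using y(1) by (simp add: powr_power power2_eq_square)
          finally have "real N ^ n * (2 * \<delta>) \<le> y powr ((real n)\<^sup>2 / (32 * t)) * (2 * \<delta>)"
            by (intro mult_right_mono) (auto simp: \<delta>_def)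
          also have "\<dots> = 2 * y powr (- ((real n)\<^sup>2 / (480 * t)))"
            using s st by (simp add: \<delta>_def powr_add[symmetric] field_simps)
          also have "\<dots> < 1"
          proof -
            have "480 * real t * 1 \<le> real n * real n"
              using tL L n0 by (intro mult_mono) auto
            then have "1 \<le> (real n)\<^sup>2 / (480 * t)"
              using s st by (simp add: power2_eq_square)
            then have "y powr 1 \<le> y powr ((real n)\<^sup>2 / (480 * t))"
              using y by (intro powr_mono) auto
            moreover have "2 * 2 * 1 \<le> 2 * exp 1 * x"
              using x exp_ge_add_one_self[of 1] by (intro mult_mono) auto
            then have "4 \<le> y" by (simp add: y_def)
            ultimately show ?thesis using y by (simp add: powr_minus field_simps)
          qed
          finally show ?thesis .
        qed
        moreover have "bernoulli_weight p ([A]\<^bsup>2\<^esup>) (clique_free s A) \<le> \<delta>"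
          if "A \<in> [{1..N}]\<^bsup>n\<^esup>" for A
        proof -
          have "bernoulli_weight p ([A]\<^bsup>2\<^esup>) (clique_free s A) \<le> (1 - p) powr ((real n)\<^sup>2 / (10 * real s))"
            using that s sL p1 p2
            by (intro elim(3)[rule_format]) (auto simp: nsets_def L_def)
          also have "\<dots> \<le> exp (- p * ((real n)\<^sup>2 / (10 * real s)))"
          proof -
            have "ln (1 - p) * ((real n)\<^sup>2 / (10 * real s)) \<le> - p * ((real n)\<^sup>2 / (10 * real s))"
              using ln_le_minus_one[of "1 - p"] p0 by (intro mult_right_mono) auto
            then show ?thesis using p0 by (simp add: powr_def mult.commute)
          qed
          also have "\<dots> \<le> exp (- (ln y / (3 * x)) * ((real n)\<^sup>2 / (10 * real s)))"
            using y(3) unfolding exp_le_cancel_iff by (intro mult_right_mono) auto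
          also have "\<dots> = \<delta>"
            using y s st by (simp add: \<delta>_def powr_def x_def field_simps)
          finally show ?thesis .
        qed
        moreover have "bernoulli_weight (1 - p) ([A]\<^bsup>2\<^esup>) (clique_free t A) \<le> \<delta>"
          if "A \<in> [{1..N}]\<^bsup>n\<^esup>" for A
        proof -
          have "bernoulli_weight (1 - p) ([A]\<^bsup>2\<^esup>) (clique_free t A) \<le>
              (1 - (1 - p)) powr ((real n)\<^sup>2 / (10 * real t))"
            using that s st t p1 p2
            by (intro elim(3)[rule_format]) (auto simp: nsets_def L_def)
          also have "\<dots> = \<delta>"
            by (simp add: p_def \<delta>_def powr_powr)
          finally show ?thesis .
        qed
        ultimately obtain E where "\<And>A. A \<in> [{1..N}]\<^bsup>n\<^esup> \<Longrightarrow>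
            \<not> clique_free s A E \<and> \<not> clique_free t A ([{1..N}]\<^bsup>2\<^esup> - E)"
          using exists_good_graph[of "{1..N}" p n s \<delta> t] p0 by (auto simp: \<delta>_def)
        then have "\<not> cover_ramsey (s + t - 2) n s t N"
          using s st by (intro not_cover_ramsey_of_graph) auto
        \<comment> \<open>The \<open>LEAST\<close> value has the property only once some value is
          known to have it.\<close>
        moreover have "\<exists>N. cover_ramsey (s + t - 2) n s t N"
          using s st tL L by (intro cover_ramsey_ex) auto
        then have "cover_ramsey (s + t - 2) n s t N"
          unfolding N_def cover_ramsey_number_def by (rule LeastI_ex)
        ultimately show False by blast
      qed
    qed
  qed
qed

subsection \<open>Upper bound\<close>

text \<open>The Erdos-Szekeres recursion along Pascal's rule. With this binomial coefficient the
  base cases \<open>a = 0\<close> and \<open>b = 0\<close> are settled by the empty set.\<close>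

lemma clique_or_independent:
  assumes "finite V" "(a + b) choose a \<le> card V"
  shows "\<exists>S \<subseteq> V. (card S = a \<and> [S]\<^bsup>2\<^esup> \<subseteq> E) \<or> (card S = b \<and> [S]\<^bsup>2\<^esup> \<inter> E = {})"
  using assms
proof (induction "a + b" arbitrary: a b V)
  case 0
  then show ?case by (intro exI[of _ "{}"]) (auto simp: nsets_2_eq)
next
  case (Suc m)
  show ?case
  proof (cases "a = 0 \<or> b = 0")
    case True
    then show ?thesis by (intro exI[of _ "{}"]) (auto simp: nsets_2_eq)
  next
    case False
    then obtain a' b' where ab: "a = Suc a'" "b = Suc b'" by (meson not0_implies_Suc)
    have binom: "(a + b) choose a = ((a' + b) choose a') + ((a + b') choose a)"
      by (simp add: ab)
    have "0 < card V" using Suc.prems(2) by (metis binomial_eq_0_iff le_add1 le_zero_eq not_gr_zero not_le)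
    then obtain v where v: "v \<in> V" by (metis card.empty ex_in_conv less_irrefl)
    define X where "X = {y \<in> V - {v}. {v, y} \<in> E}"
    define Y where "Y = {y \<in> V - {v}. {v, y} \<notin> E}"
    have fin: "finite X" "finite Y" using Suc.prems by (auto simp: X_def Y_def)
    have "card X + card Y = card (X \<union> Y)"
      using fin by (intro card_Un_disjoint[symmetric]) (auto simp: X_def Y_def)
    also have "X \<union> Y = V - {v}" by (auto simp: X_def Y_def)
    also have "card (V - {v}) = card V - 1" using v by simp
    \<comment> \<open>If both classes were too small, \<open>V\<close> would have at most
      \<open>card V - 2\<close> vertices besides \<open>v\<close>.\<close>
    finally have "(a' + b) choose a' \<le> card X \<or> (a + b') choose a \<le> card Y"
      using Suc.prems(2) binom by linarith
    then show ?thesis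
    proof
      assume "(a' + b) choose a' \<le> card X"
      then obtain S where S: "S \<subseteq> X"
        "(card S = a' \<and> [S]\<^bsup>2\<^esup> \<subseteq> E) \<or> (card S = b \<and> [S]\<^bsup>2\<^esup> \<inter> E = {})"
        using Suc.hyps(1)[of a' b X] Suc.hyps(2) fin ab by auto
      have vS: "v \<notin> S" "finite S" using S(1) fin finite_subset by (auto simp: X_def)
      show ?thesis
      proof (cases "card S = b \<and> [S]\<^bsup>2\<^esup> \<inter> E = {}")
        case True
        then show ?thesis using S(1) by (auto simp: X_def)
      next
        case False
        then have "card (insert v S) = a \<and> [insert v S]\<^bsup>2\<^esup> \<subseteq> E"
          using S vS ab by (auto simp: nsets2_insert X_def)
        then show ?thesis using S(1) v by (intro exI[of _ "insert v S"]) (auto simp: X_def)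
      qed
    next
      assume "(a + b') choose a \<le> card Y"
      then obtain S where S: "S \<subseteq> Y"
        "(card S = a \<and> [S]\<^bsup>2\<^esup> \<subseteq> E) \<or> (card S = b' \<and> [S]\<^bsup>2\<^esup> \<inter> E = {})"
        using Suc.hyps(1)[of a b' Y] Suc.hyps(2) fin ab by auto
      have vS: "v \<notin> S" "finite S" using S(1) fin finite_subset by (auto simp: Y_def)
      show ?thesis
      proof (cases "card S = a \<and> [S]\<^bsup>2\<^esup> \<subseteq> E")
        case True
        then show ?thesis using S(1) by (auto simp: Y_def)
      next
        case False
        then have "card (insert v S) = b \<and> [insert v S]\<^bsup>2\<^esup> \<inter> E = {}"
          using S vS ab by (auto simp: nsets2_insert Y_def)
        then show ?thesis using S(1) v by (intro exI[of _ "insert v S"]) (auto simp: Y_def)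
      qed
    qed
  qed
qed

text \<open>A set avoiding \<open>F\<close> has at most one point in \<open>S\<close> and keeps
  \<open>Suc i\<close> points in \<open>A\<close>. Adding a homogeneous set thus raises the size
  bound by only one.\<close>

lemma union_of_homogeneous:
  assumes S: "finite S" "[S]\<^bsup>2\<^esup> \<subseteq> F"
    and A: "\<And>I. I \<in> [A]\<^bsup>Suc i\<^esup> \<Longrightarrow> [I]\<^bsup>2\<^esup> \<inter> F \<noteq> {}" and I: "I \<in> [S \<union> A]\<^bsup>Suc (Suc i)\<^esup>"
  shows "[I]\<^bsup>2\<^esup> \<inter> F \<noteq> {}"
proof
  assume free: "[I]\<^bsup>2\<^esup> \<inter> F = {}"
  have finI: "finite I" and cardI: "card I = Suc (Suc i)" using I by (auto simp: nsets_def)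
  have "card (I \<inter> S) \<le> 1" by (rule card_Int_homogeneous[OF S free])
  then have "Suc i \<le> card (I - S)"
    using card_Diff_subset_Int[of I S] finI cardI by simp
  then obtain J where J: "J \<subseteq> I - S" "card J = Suc i" "finite J"
    using obtain_subset_with_card_n by metis
  then have "J \<in> [A]\<^bsup>Suc i\<^esup>" using I by (auto simp: nsets_def)
  then have "[J]\<^bsup>2\<^esup> \<inter> F \<noteq> {}" by (rule A)
  moreover have "[J]\<^bsup>2\<^esup> \<subseteq> [I]\<^bsup>2\<^esup>" using J by (intro nsets_mono) auto
  ultimately show False using free by blast
qed

text \<open>Homogeneous sets are removed one by one until there are \<open>i\<close> cliques or
  \<open>j\<close> independent sets, whose union is \<open>A\<close>. The summands
  \<open>i * a\<close> and \<open>j * b\<close> pay for the removed vertices.\<close>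

lemma few_cliques_or_few_independents:
  assumes "finite V" "((a + b) choose a) + i * a + j * b \<le> card V"
  shows "\<exists>A \<subseteq> V. (card A = i * a \<and> (\<forall>T \<in> [A]\<^bsup>Suc i\<^esup>. [T]\<^bsup>2\<^esup> \<inter> E \<noteq> {})) \<or>
    (card A = j * b \<and> (\<forall>T \<in> [A]\<^bsup>Suc j\<^esup>. [T]\<^bsup>2\<^esup> \<inter> - E \<noteq> {}))"
  using assms
proof (induction "i + j" arbitrary: i j V)
  case 0
  then show ?case by (intro exI[of _ "{}"]) (auto simp: nsets_def)
next
  case (Suc m)
  show ?case
  proof (cases "i = 0 \<or> j = 0")
    case True
    then show ?thesis by (intro exI[of _ "{}"]) (auto simp: nsets_def)
  next
    case False
    then obtain i' j' where ij: "i = Suc i'" "j = Suc j'" by (meson not0_implies_Suc)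
    have "(a + b) choose a \<le> card V" using Suc.prems by linarith
    then obtain S where S: "S \<subseteq> V"
      "(card S = a \<and> [S]\<^bsup>2\<^esup> \<subseteq> E) \<or> (card S = b \<and> [S]\<^bsup>2\<^esup> \<inter> E = {})"
      using clique_or_independent[OF Suc.prems(1), of a b E] by blast
    have finS: "finite S" and finVS: "finite (V - S)" using S(1) Suc.prems finite_subset by auto
    have cardVS: "card (V - S) = card V - card S" using S(1) finS by (simp add: card_Diff_subset)
    have card_un: "card (S \<union> A) = card S + card A" if "A \<subseteq> V - S" for A
      using that finS finVS finite_subset by (intro card_Un_disjoint) auto
    from S(2) show ?thesis
    proof
      assume Sa: "card S = a \<and> [S]\<^bsup>2\<^esup> \<subseteq> E"
      then have "((a + b) choose a) + i' * a + j * b \<le> card (V - S)"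
        using Suc.prems(2) cardVS ij by simp
      then obtain A where A: "A \<subseteq> V - S"
        "(card A = i' * a \<and> (\<forall>T \<in> [A]\<^bsup>Suc i'\<^esup>. [T]\<^bsup>2\<^esup> \<inter> E \<noteq> {})) \<or>
         (card A = j * b \<and> (\<forall>T \<in> [A]\<^bsup>Suc j\<^esup>. [T]\<^bsup>2\<^esup> \<inter> - E \<noteq> {}))"
        using Suc.hyps(1)[of i' j "V - S"] Suc.hyps(2) finVS ij by auto
      from A(2) show ?thesis
      proof
        assume A': "card A = i' * a \<and> (\<forall>T \<in> [A]\<^bsup>Suc i'\<^esup>. [T]\<^bsup>2\<^esup> \<inter> E \<noteq> {})"
        then have "card (S \<union> A) = i * a" using card_un[OF A(1)] Sa ij by simp
        moreover have "\<forall>T \<in> [S \<union> A]\<^bsup>Suc i\<^esup>. [T]\<^bsup>2\<^esup> \<inter> E \<noteq> {}"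
          using union_of_homogeneous[OF finS, of E A i'] Sa A' ij by blast
        ultimately show ?thesis using A(1) S(1) by (intro exI[of _ "S \<union> A"]) blast
      qed (use A(1) in blast)
    next
      assume Sb: "card S = b \<and> [S]\<^bsup>2\<^esup> \<inter> E = {}"
      then have "((a + b) choose a) + i * a + j' * b \<le> card (V - S)"
        using Suc.prems(2) cardVS ij by simp
      then obtain A where A: "A \<subseteq> V - S"
        "(card A = i * a \<and> (\<forall>T \<in> [A]\<^bsup>Suc i\<^esup>. [T]\<^bsup>2\<^esup> \<inter> E \<noteq> {})) \<or>
         (card A = j' * b \<and> (\<forall>T \<in> [A]\<^bsup>Suc j'\<^esup>. [T]\<^bsup>2\<^esup> \<inter> - E \<noteq> {}))"
        using Suc.hyps(1)[of i j' "V - S"] Suc.hyps(2) finVS ij by auto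
      from A(2) show ?thesis
      proof (elim disjE)
        assume A': "card A = j' * b \<and> (\<forall>T \<in> [A]\<^bsup>Suc j'\<^esup>. [T]\<^bsup>2\<^esup> \<inter> - E \<noteq> {})"
        then have "card (S \<union> A) = j * b" using card_un[OF A(1)] Sb ij by simp
        moreover have "\<forall>T \<in> [S \<union> A]\<^bsup>Suc j\<^esup>. [T]\<^bsup>2\<^esup> \<inter> - E \<noteq> {}"
          using union_of_homogeneous[OF finS, of "- E" A j'] Sb A' ij by blast
        ultimately show ?thesis using A(1) S(1) by (intro exI[of _ "S \<union> A"]) blast
      qed (use A(1) in blast)
    qed
  qed
qed

text \<open>An \<open>s\<close>-set is bad if no red \<open>k\<close>-set contains it, and
  \<open>E\<close> collects the pairs inside bad sets. A \<open>t\<close>-set containing such a pair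
  shares two points with a bad set; both fit into one \<open>k\<close>-set, which must be blue. An
  \<open>s\<close>-set containing a nonedge is not bad.\<close>

lemma cover_ramsey_of_large:
  assumes s: "2 \<le> s" and t: "2 \<le> t" and kN: "s + t - 2 \<le> N"
    and N: "((a + b) choose a) + (t - 1) * a + (s - 1) * b \<le> N"
    and n: "n \<le> (t - 1) * a" "n \<le> (s - 1) * b"
  shows "cover_ramsey (s + t - 2) n s t N"
  unfolding cover_ramsey_def
proof
  fix \<chi> :: "nat set \<Rightarrow> color"
  let ?V = "{1..N}" and ?k = "s + t - 2"
  define bad where "bad S \<longleftrightarrow> S \<in> [?V]\<^bsup>s\<^esup> \<and> \<not> (\<exists>K \<in> [?V]\<^bsup>?k\<^esup>. S \<subseteq> K \<and> \<chi> K = Red)" for S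
  define E where "E = {e \<in> [?V]\<^bsup>2\<^esup>. \<exists>S. bad S \<and> e \<subseteq> S}"
  obtain A where A: "A \<subseteq> ?V"
    "(card A = (t - 1) * a \<and> (\<forall>T \<in> [A]\<^bsup>Suc (t - 1)\<^esup>. [T]\<^bsup>2\<^esup> \<inter> E \<noteq> {})) \<or>
     (card A = (s - 1) * b \<and> (\<forall>T \<in> [A]\<^bsup>Suc (s - 1)\<^esup>. [T]\<^bsup>2\<^esup> \<inter> - E \<noteq> {}))"
    using few_cliques_or_few_independents[of ?V a b "t - 1" "s - 1" E] N by auto
  then have "n \<le> card A" using n by auto
  then obtain B where B: "B \<subseteq> A" "card B = n" "finite B"
    using obtain_subset_with_card_n by metis
  have BV: "B \<in> [?V]\<^bsup>n\<^esup>" using A(1) B by (auto simp: nsets_def)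
  have "covered \<chi> Red ?k N s B \<or> covered \<chi> Blue ?k N t B"
    using A(2)
  proof
    assume T: "card A = (t - 1) * a \<and> (\<forall>T \<in> [A]\<^bsup>Suc (t - 1)\<^esup>. [T]\<^bsup>2\<^esup> \<inter> E \<noteq> {})"
    have "\<exists>K \<in> [?V]\<^bsup>?k\<^esup>. T \<subseteq> K \<and> \<chi> K = Blue" if TB: "T \<in> [B]\<^bsup>t\<^esup>" for T
    proof -
      have "T \<in> [A]\<^bsup>Suc (t - 1)\<^esup>" using TB B(1) t by (auto simp: nsets_def)
      then obtain e where e: "e \<in> [T]\<^bsup>2\<^esup>" "e \<in> E" using T by blast
      then obtain S where S: "bad S" "e \<subseteq> S" by (auto simp: E_def)
      have fin: "finite S" "card S = s" "S \<subseteq> ?V" using S(1) by (auto simp: bad_def nsets_def)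
      have finT: "finite T" "card T = t" "T \<subseteq> ?V" using TB B(1) A(1) by (auto simp: nsets_def)
      have "e \<subseteq> S \<inter> T" "card e = 2" using e(1) S(2) by (auto simp: nsets_def)
      then have "2 \<le> card (S \<inter> T)" using fin(1) by (metis card_mono finite_Int)
      then have "card (S \<union> T) \<le> ?k"
        using card_Un_Int[OF fin(1) finT(1)] fin(2) finT(2) by linarith
      moreover have "S \<union> T \<subseteq> ?V" using fin finT by blast
      ultimately obtain K where K: "S \<union> T \<subseteq> K" "K \<subseteq> ?V" "card K = ?k"
        using exists_subset_between[of "S \<union> T" ?k ?V] kN by auto
      then have KV: "K \<in> [?V]\<^bsup>?k\<^esup>" using finite_subset by (auto simp: nsets_def)
      then have "\<chi> K \<noteq> Red" using S(1) K(1) by (auto simp: bad_def)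
      then have "\<chi> K = Blue" by (cases "\<chi> K") auto
      then show ?thesis using KV K(1) by blast
    qed
    then show ?thesis by (simp add: covered_def)
  next
    assume S: "card A = (s - 1) * b \<and> (\<forall>T \<in> [A]\<^bsup>Suc (s - 1)\<^esup>. [T]\<^bsup>2\<^esup> \<inter> - E \<noteq> {})"
    have "\<exists>K \<in> [?V]\<^bsup>?k\<^esup>. S \<subseteq> K \<and> \<chi> K = Red" if SB: "S \<in> [B]\<^bsup>s\<^esup>" for S
    proof (rule ccontr)
      assume no: "\<not> ?thesis"
      have "S \<in> [?V]\<^bsup>s\<^esup>" using SB BV by (auto simp: nsets_def)
      then have "bad S" using no by (simp add: bad_def)
      then have "[S]\<^bsup>2\<^esup> \<subseteq> E" by (auto simp: E_def bad_def nsets_def)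
      moreover have "S \<in> [A]\<^bsup>Suc (s - 1)\<^esup>" using SB B(1) s by (auto simp: nsets_def)
      ultimately show False using \<open>card A = _ \<and> _\<close> by blast
    qed
    then show ?thesis by (simp add: covered_def)
  qed
  then show "\<exists>A \<in> [?V]\<^bsup>n\<^esup>. covered \<chi> Red ?k N s A \<or> covered \<chi> Blue ?k N t A"
    using BV by blast
qed

text \<open>One term of the binomial expansion of (x + 1)^(a + b) at x = a/b, where (x + 1)^b \<le>
  exp(xb) = exp(a).\<close>

lemma binomial_le_exp_power:
  assumes a: "0 < a"
  shows "real ((a + b) choose a) \<le> (exp 1 * (1 + real b / real a)) ^ a"
proof (cases "b = 0")
  case True
  then show ?thesis using exp_ge_add_one_self[of 1] one_le_power[of "exp (1 :: real)" a] by simp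
next
  case False
  define x where "x = real a / real b"
  have x: "0 < x" using a False by (simp add: x_def)
  have "real ((a + b) choose a) * x ^ a \<le> (\<Sum>k \<le> a + b. real ((a + b) choose k) * x ^ k)"
    using x by (intro member_le_sum) auto
  also have "\<dots> = (x + 1) ^ (a + b)" by (simp add: binomial_ring)
  also have "\<dots> \<le> (x + 1) ^ a * exp a"
  proof -
    have "(x + 1) ^ b \<le> exp x ^ b"
      using x exp_ge_add_one_self[of x] by (intro power_mono) (auto simp: add.commute)
    also have "\<dots> = exp a" using False by (simp add: x_def flip: exp_of_nat_mult)
    finally show ?thesis using x by (simp add: power_add)
  qed
  finally have "real ((a + b) choose a) \<le> (x + 1) ^ a * exp 1 ^ a / x ^ a"
    using x by (simp add: field_simps flip: exp_of_nat_mult)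
  also have "\<dots> = (exp 1 * (1 + real b / real a)) ^ a"
  proof -
    have "(x + 1) * exp 1 / x = exp 1 * (1 + real b / real a)"
      using a False by (simp add: x_def field_simps)
    then show ?thesis by (metis power_divide power_mult_distrib)
  qed
  finally show ?thesis .
qed

text \<open>\<open>a\<close> and \<open>b\<close> are the quotients of \<open>n\<close> by
  \<open>t - 1\<close> and \<open>s - 1\<close>, rounded so that
  \<open>cover_ramsey_of_large\<close> applies. The binomial coefficient is at most y^(3n/t), and a
  further y^(n/t) absorbs the lower-order terms.\<close>

lemma cover_ramsey_number_upper:
  "\<forall>\<^sub>F n in sequentially. \<forall>s t :: nat.
    2 \<le> s \<and> s \<le> t \<and> real t \<le> log 2 (real n) / (120 * log 2 (log 2 (real n))) \<longrightarrow>
      real (cover_ramsey_number (s + t - 2) n s t)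
        \<le> 2 powr (4 * real n / real t * log 2 (2 * exp 1 * real t / real s))"
proof -
  have "\<forall>\<^sub>F n in sequentially. 4 \<le> log 2 (real n)" by real_asymp
  moreover have "\<forall>\<^sub>F n in sequentially. (log 2 (real n))\<^sup>2 \<le> real n" by real_asymp
  moreover have "\<forall>\<^sub>F n in sequentially. 5 * real n + 1 \<le> 2 powr (real n / log 2 (real n))"
    by real_asymp
  ultimately show ?thesis
  proof eventually_elim
    case (elim n)
    show ?case
    proof (intro allI impI, elim conjE)
      fix s t :: nat
      assume s: "2 \<le> s" and st: "s \<le> t"
        and t: "real t \<le> log 2 (real n) / (120 * log 2 (log 2 (real n)))"
      define L where "L = log 2 (real n)"
      have L: "4 \<le> L" "L\<^sup>2 \<le> n" "5 * real n + 1 \<le> 2 powr (real n / L)" using elim by (auto simp: L_def)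
      have tL: "120 * real t \<le> L" using L(1) t by (intro mult_120_le) (auto simp: L_def)
      have tn: "120 * real t * real t \<le> n"
      proof -
        have "120 * real t * real t \<le> L * L" using tL L by (intro mult_mono) auto
        then show ?thesis using L(2) by (simp add: power2_eq_square)
      qed
      have t1: "1 \<le> real t" using s st by simp
      have "real t * 1 \<le> 120 * real t * real t" using t1 by (intro mult_mono) auto
      then have tn1: "real t \<le> n" using tn by linarith
      define a where "a = n div (t - 1) + 1"
      define b where "b = n div (s - 1) + 1"
      define y where "y = 2 * exp 1 * real t / real s"
      \<comment> \<open>The constant is chosen to give y \<ge> 2e \<ge> 81/16 = (3/2)^4.\<close>
      have e: "81 / 32 \<le> exp (1 :: real)"
      proof -
        have "81 / 32 \<le> (1 + 1 / 2 + (1 / 2)\<^sup>2 / 2 :: real)\<^sup>2" by (simp add: power2_eq_square)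
        also have "\<dots> \<le> (exp (1 / 2))\<^sup>2"
          by (intro power_mono exp_lower_Taylor_quadratic) auto
        also have "\<dots> = exp 1" by (simp flip: exp_double)
        finally show ?thesis .
      qed
      have y5: "81 / 16 \<le> y"
      proof -
        have "81 / 16 * real s \<le> 2 * exp 1 * real t"
          using e st by (intro mult_mono) linarith+
        then show ?thesis using s by (simp add: y_def field_simps)
      qed
      have mult_div: "k * (n div k + 1) \<le> n + k" for k :: nat
        by (simp add: distrib_left)
      have mult_div': "n \<le> k * (n div k + 1)" if "0 < k" for k :: nat
        using that dividend_less_times_div[of k n] by (simp add: distrib_left)
      have div_le: "real (n div k) \<le> n / real k" if "0 < k" for k :: nat
        using that div_times_less_eq_dividend[of n k]
        by (simp add: field_simps flip: of_nat_mult)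
      have real_b: "real b \<le> n / (real s - 1) + 1"
        using s div_le[of "s - 1"] by (simp add: b_def of_nat_diff)
      have real_a: "real a \<le> n / (real t - 1) + 1"
        using s st div_le[of "t - 1"] by (simp add: a_def of_nat_diff)
      have "real n \<le> real ((t - 1) * a)"
        using mult_div'[of "t - 1"] s st unfolding a_def of_nat_le_iff by simp
      then have a_ge: "n / (real t - 1) \<le> real a"
        using s st by (simp add: of_nat_diff field_simps)
      \<comment> \<open>From b/a \<le> 2t/s and 1 \<le> t/s the left side is at most 3et/s = 3y/2,
        and 3/2 \<le> y^(1/4).\<close>
      have ratio: "exp 1 * (1 + real b / real a) \<le> y powr (5 / 4)"
      proof -
        have a0: "0 < real a" by (simp add: a_def)
        have "real b \<le> (real t - 1) / (real s - 1) * real a + (real t - 1) / n * real a"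
        proof -
          have "n / (real s - 1) = (real t - 1) / (real s - 1) * (n / (real t - 1))"
            using s st by simp
          also have "\<dots> \<le> (real t - 1) / (real s - 1) * real a"
            using s st by (intro mult_left_mono a_ge) auto
          finally have "n / (real s - 1) \<le> (real t - 1) / (real s - 1) * real a" .
          \<comment> \<open>The rounding term 1 in the bound on \<open>b\<close> also becomes a
            multiple of \<open>a\<close>.\<close>
          moreover have "1 = (real t - 1) / n * (n / (real t - 1))"
            using s st tn1 by simp
          then have "1 \<le> (real t - 1) / n * real a"
            using mult_left_mono[OF a_ge, of "(real t - 1) / n"] s st by simp
          ultimately show ?thesis using real_b by linarith
        qed
        then have "real b / real a \<le> (real t - 1) / (real s - 1) + (real t - 1) / n"
          using a0 by (simp add: field_simps)
        also have "\<dots> \<le> 2 * (real t - 1) / s + 2 / s"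
        proof (rule add_mono)
          have "(real t - 1) / (real s - 1) \<le> (real t - 1) / (real s / 2)"
            using s st by (intro divide_left_mono) auto
          then show "(real t - 1) / (real s - 1) \<le> 2 * (real t - 1) / s" by (simp add: mult.commute)
          have "(real t - 1) / n \<le> t / (t * t)"
            using tn t1 by (intro frac_le) auto
          also have "\<dots> \<le> 2 / s" using s st by (simp add: field_simps)
          finally show "(real t - 1) / n \<le> 2 / s" .
        qed
        also have "\<dots> = 2 * t / s"
          by (simp add: algebra_simps flip: add_divide_distrib)
        finally have "exp 1 * (1 + real b / real a) \<le> exp 1 * (t / s + 2 * t / s)"
          using s st by (intro mult_left_mono add_mono) auto
        also have "\<dots> = 3 / 2 * y" by (simp add: y_def)
        also have "\<dots> \<le> y powr (1 / 4) * y"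
        proof (rule mult_right_mono)
          have "3 / 2 = ((3 / 2) powr 4 :: real) powr (1 / 4)"
            by (simp only: powr_powr) simp
          also have "\<dots> \<le> y powr (1 / 4)"
            using y5 by (intro powr_mono2) (auto simp: power_divide)
          finally show "3 / 2 \<le> y powr (1 / 4)" .
        qed (use y5 in simp)
        also have "\<dots> = y powr (5 / 4)"
          using y5 by (simp add: powr_mult_base mult.commute)
        finally show ?thesis .
      qed
      have "real ((a + b) choose a) \<le> (exp 1 * (1 + real b / real a)) ^ a"
        by (rule binomial_le_exp_power) (simp add: a_def)
      also have "\<dots> \<le> (y powr (5 / 4)) ^ a"
        using ratio by (intro power_mono) auto
      also have "\<dots> = y powr (5 / 4 * a)" using y5 by (simp add: powr_power mult.commute)
      \<comment> \<open>Here \<open>a\<close> is at most 2n/t + 1, and n/t \<ge> 120 absorbs the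
        constant 5/4.\<close>
      also have "\<dots> \<le> y powr (3 * n / t)"
      proof (rule powr_mono)
        have "n / (real t - 1) \<le> n / (real t / 2)"
          using s st by (intro divide_left_mono) auto
        then have "n / (real t - 1) \<le> 2 * n / t" by (simp add: mult.commute)
        then have "5 / 4 * real a \<le> 5 / 4 * (2 * n / t + 1)"
          using real_a by simp
        moreover have "120 * real t * 1 \<le> 120 * real t * real t"
          using t1 by (intro mult_left_mono) auto
        then have "120 * real t \<le> n" using tn by linarith
        then have "120 \<le> n / t" using t1 by (simp add: le_divide_eq)
        ultimately show "5 / 4 * real a \<le> 3 * n / t" by simp
      qed (use y5 in simp)
      finally have choose: "real ((a + b) choose a) \<le> y powr (3 * n / t)" .
      \<comment> \<open>The linear term is covered by y^(n/t) \<ge> 2^(n/L) \<ge> 5n + 1.\<close>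
      have large: "real ((a + b) choose a) + 5 * n + 1 \<le> y powr (4 * n / t)"
      proof -
        define u where "u = y powr (n / t)"
        define w where "w = y powr (3 * n / t)"
        have "n / L \<le> n / t" using tL t1 by (intro divide_left_mono) auto
        then have "2 powr (n / L) \<le> 2 powr (n / t)" by simp
        also have "\<dots> \<le> u" unfolding u_def using y5 by (intro powr_mono2) auto
        finally have u: "5 * n + 1 \<le> u" using L(3) by linarith
        have w1: "1 \<le> w" "u \<le> w"
          unfolding w_def u_def using y5 ge_one_powr_ge_zero[of y "3 * n / t"]
          by (auto intro!: powr_mono divide_right_mono)
        have "2 * w \<le> u * w" using u tn1 t1 w1 by (intro mult_right_mono) linarith+
        also have "u * w = y powr (4 * n / t)"
          by (simp add: u_def w_def powr_add[symmetric] add_divide_distrib[symmetric])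
        finally show ?thesis using choose u w1 unfolding w_def[symmetric] by linarith
      qed
      define N where "N = nat \<lfloor>y powr (4 * n / t)\<rfloor>"
      have N: "real N \<le> y powr (4 * n / t)" "y powr (4 * n / t) < N + 1"
        unfolding N_def by (auto simp: of_nat_nat) linarith
      have "cover_ramsey (s + t - 2) n s t N"
      proof (rule cover_ramsey_of_large)
        \<comment> \<open>The summand 1 in \<open>large\<close> makes up for rounding down in
          \<open>N\<close>. The removed sets need at most 2n + s + t - 2 vertices, which is below
          5n.\<close>
        have "real ((a + b) choose a) + 5 * n < N" using large N by linarith
        then have "((a + b) choose a) + 5 * n < N" by linarith
        moreover have "(t - 1) * a \<le> n + (t - 1)" "(s - 1) * b \<le> n + (s - 1)"
          unfolding a_def b_def by (rule mult_div)+
        ultimately show "((a + b) choose a) + (t - 1) * a + (s - 1) * b \<le> N" "s + t - 2 \<le> N"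
          using st tn1 by linarith+
        show "n \<le> (t - 1) * a" "n \<le> (s - 1) * b"
          unfolding a_def b_def using s st by (intro mult_div'; simp)+
      qed (use s st in auto)
      then have "cover_ramsey_number (s + t - 2) n s t \<le> N"
        unfolding cover_ramsey_number_def by (rule Least_le)
      then have "real (cover_ramsey_number (s + t - 2) n s t) \<le> y powr (4 * n / t)"
        using N by linarith
      also have "\<dots> = 2 powr (4 * real n / real t * log 2 (2 * exp 1 * real t / real s))"
        using y5 by (simp add: powr_def log_def flip: y_def)
      finally show "real (cover_ramsey_number (s + t - 2) n s t)
          \<le> 2 powr (4 * real n / real t * log 2 (2 * exp 1 * real t / real s))" .
    qed
  qed
qed

theorem theorem1p1:
  shows "\<exists>n0 :: nat. \<forall>n \<ge> n0. \<forall>s t :: nat.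
    2 \<le> s \<and> s \<le> t \<and> real t \<le> log 2 (real n) / (120 * log 2 (log 2 (real n))) \<longrightarrow>
      2 powr (real n / (32 * real t) * log 2 (2 * exp 1 * real t / real s))
        \<le> real (cover_ramsey_number (s + t - 2) n s t)
    \<and> real (cover_ramsey_number (s + t - 2) n s t)
        \<le> 2 powr (4 * real n / real t * log 2 (2 * exp 1 * real t / real s))"
  using eventually_conj[OF cover_ramsey_number_lower cover_ramsey_number_upper]
  unfolding eventually_sequentially by blast

end
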